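(* Let $\{\mathcal{X},p(y|x),\mathcal{Y}\}$ be a discrete memoryless channel whose input alphabet is the $M$-ASK alphabet $\mathcal{X}=\{-M+1,-M+3,\dots,M-1\}$ with $M=2^{m+1}$, $m\ge 1$. Let $\mathcal{S}=\{-1,+1\}$, $\mathcal{A}=\{1,3,\dots,M-1\}$, and let $f:\{0,1\}^m\to\mathcal{A}$ be a bijection (amplitude labeling). For a probability distribution $p(\boldsymbol{b})=p(b_1,\dots,b_m)$ on $\{0,1\}^m$, let $\boldsymbol{B}=(B_1,\dots,B_m)\sim p(\boldsymbol{b})$, let $S$ be uniform on $\mathcal{S}$ and independent of $\boldsymbol{B}$, let $X=S\,f(\boldsymbol{B})$, whose distribution is identified with $p(x)=p(s,b_1,\dots,b_m)$, and let $Y$ be the channel output when $X$ is the channel input. Put $$R_{\mathrm{BMD}}(p(x))=H(S,B_1,\dots,B_m)-H(S|Y)-\sum_{i=1}^m H(B_i|Y).$$ Then the rate $$R_{\mathrm{BMD}}^{\gamma=0}=\max_{p(\boldsymbol{b}):\,H(\boldsymbol{B})\le R_{\mathrm{BMD}}(p(x))} H(\boldsymbol{B})$$ is achievable with amplitude shaping and basic sign-coding, using bit-metric decoding (BMD).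
   Context: Conventions. Logarithms are base 2 and entropies are in bits. The output alphabet $\mathcal{Y}$ is discrete and all entropies involved are finite (automatic if $\mathcal{Y}$ is finite). The channel is memoryless: $p(\underline{y}|\underline{x})=\prod_{i=1}^n p(y_i|x_i)$. Underlined letters denote length-$n$ sequences, and $\otimes$ is element-wise multiplication. Typical sets. Let $(X_1,\dots,X_k)$ be discrete random variables with joint distribution $p(x_1,\dots,x_k)$, and let $\varepsilon>0$. The weakly jointly typical set $\mathcal{A}^n_\varepsilon(X_1\cdots X_k)$ is the set of tuples $(\underline{x}_1,\dots,\underline{x}_k)$ of length-$n$ sequences such that, for every nonempty $J\subseteq\{1,\dots,k\}$, $\left|-\frac1n\log p(\underline{x}_J)-H(X_J)\right|\le\varepsilon$, where $\underline{x}_J=(\underline{x}_j)_{j\in J}$, $X_J=(X_j)_{j\in J}$, and $p(\underline{x}_J)$ is the $n$-fold product of the marginal distribution of $X_J$. $\mathcal{B}$-typical set. For discrete random variables $(U,V)$, possibly composite, with $p(u,v)=p(u)p(v|u)$, define $$\mathcal{B}^n_{V,\varepsilon}(U)=\Big\{\underline{u}:\ \underline{u}\in\mathcal{A}^n_\varepsilon(U)\ \text{and}\ \Pr\{(\underline{u},\underline{V})\in\mathcal{A}^n_\varepsilon(UV)\mid \underline{U}=\underline{u}\}\ge 1-\varepsilon\Big\},$$ where, given $\underline{U}=\underline{u}$, $\underline{V}$ has distribution $\prod_i p(v_i|u_i)$. When $U$ or $V$ is composite, the typicality conditions are those of the collection of its components: $\mathcal{B}^n_{SY,\varepsilon}(B_1\cdots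 B_m)$ is the case $U=(B_1,\dots,B_m)$, $V=(S,Y)$, with $\mathcal{A}^n_\varepsilon(U)=\mathcal{A}^n_\varepsilon(B_1\cdots B_m)$ and $\mathcal{A}^n_\varepsilon(UV)=\mathcal{A}^n_\varepsilon(B_1\cdots B_m S Y)$. Basic sign-coding encoder with BMD. Its parameters are a distribution $p(\boldsymbol{b})$ on $\{0,1\}^m$ (which determines the joint distribution of $(\boldsymbol{B},S,Y)$ with $S$ uniform and independent of $\boldsymbol{B}$), a number $\varepsilon>0$, and a blocklength $n$. The message $m_a$ is uniform on $\{1,\dots,M_a\}$; there is no additional message, i.e. $M_s=1$. A shaping layer maps messages one-to-one to $m$-tuples of binary sequences $\underline{\boldsymbol{b}}(m_a)=(\underline{b}_1(m_a),\dots,\underline{b}_m(m_a))\in\mathcal{B}^n_{SY,\varepsilon}(B_1\cdots B_m)$; applying $f$ symbol-wise gives the amplitude sequence $\underline{a}(m_a)\in\mathcal{A}^n$. A coding layer assigns to each $m_a$ a sign sequence $\underline{s}(m_a)\in\mathcal{S}^n$ (a function of $\underline{a}(m_a)$). The transmitted sequence is $\underline{x}(m_a)=\underline{a}(m_a)\otimes\underline{s}(m_a)$. BMD. Upon receiving $\underline{y}$, the decoder outputs the unique index $\hat m_a$ such that $(\underline{s}(\hat m_a),\underline{y})\in\mathcal{A}^n_\varepsilon(SY)$ and $(\underline{b}_j(\hat m_a),\underline{y})\in\mathcal{A}^n_\varepsilon(B_jY)$ for every $j=1,\dots,m$; if there is no such unique index, an error is declared. The error probability is $P_e=\Pr\{\hat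 m_a\ne m_a\}$. Achievability. A rate $R$ is achievable (with basic sign-coding, using BMD) if for every $\delta>0$ and all $n$ large enough there exists a basic sign-coding encoder of blocklength $n$ (that is, a distribution $p(\boldsymbol{b})$ on $\{0,1\}^m$, a number $\varepsilon>0$, an integer $M_a\ge 1$ with $M_s=1$, a one-to-one map $m_a\mapsto\underline{\boldsymbol{b}}(m_a)\in\mathcal{B}^n_{SY,\varepsilon}(B_1\cdots B_m)$ with $\underline{a}(m_a)$ obtained by applying $f$ symbol-wise, and sign sequences $\underline{s}(m_a)\in\mathcal{S}^n$, $m_a=1,\dots,M_a$) such that, when $\underline{x}(m_a)=\underline{a}(m_a)\otimes\underline{s}(m_a)$ is transmitted and the decoder is the BMD decoder that outputs the unique $\hat m_a$ with $(\underline{s}(\hat m_a),\underline{y})\in\mathcal{A}^n_\varepsilon(SY)$ and $(\underline{b}_j(\hat m_a),\underline{y})\in\mathcal{A}^n_\varepsilon(B_jY)$ for every $j=1,\dots,m$, for the same $p(\boldsymbol{b})$ and $\varepsilon$, one has $\frac1n\log_2(M_aM_s)\ge R-\delta$ and $P_e\le\delta$. *)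

theory Defs
  imports "HOL-Probability.Probability"
begin

section \<open>Jointly distributed discrete random variables\<close>

text \<open>
  A collection of random variables \<open>(X\<^sub>k)\<close> with values in a common type is given by its joint
  law \<open>P\<close>, a pmf on functions \<open>'k \<Rightarrow> 'v\<close>.  For a set of indices \<open>J\<close>, the composite variable
  \<open>X\<^sub>J\<close> is the projection \<open>restrict _ J\<close>.  For an infinite countable range the library entropies are
  Bochner integrals, which are meaningful only under \<open>has_finite_entropy\<close>.
\<close>

abbreviation sub :: "'k set \<Rightarrow> ('k \<Rightarrow> 'v) \<Rightarrow> 'k \<Rightarrow> 'v" where
  "sub J x \<equiv> restrict x J"

definition marginal :: "('k \<Rightarrow> 'v) pmf \<Rightarrow> 'k set \<Rightarrow> ('k \<Rightarrow> 'v) pmf" where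
  "marginal P J = map_pmf (sub J) P"

definition ent :: "('k \<Rightarrow> 'v) pmf \<Rightarrow> 'k set \<Rightarrow> real" where
  "ent P J = prob_space.entropy (measure_pmf P) 2 (count_space UNIV) (sub J)"

definition cond_ent :: "('k \<Rightarrow> 'v) pmf \<Rightarrow> 'k set \<Rightarrow> 'k set \<Rightarrow> real" where
  "cond_ent P J K =
     prob_space.conditional_entropy (measure_pmf P) 2
       (count_space UNIV) (count_space UNIV) (sub J) (sub K)"

definition has_finite_entropy :: "('k \<Rightarrow> 'v) pmf \<Rightarrow> 'k set \<Rightarrow> bool" where
  "has_finite_entropy P J \<longleftrightarrow>
     information_space.finite_entropy (measure_pmf P) 2 (count_space UNIV) (sub J)
       (pmf (marginal P J))"


section \<open>Typical sets\<close>

text \<open>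
  Sequences of length \<open>n\<close> are functions on \<open>nat\<close> of which only the arguments below \<open>n\<close> are
  inspected; likewise membership in \<open>typical P K n \<epsilon>\<close> inspects only the components in \<open>K\<close>.
  Positivity of the probability is required explicitly since \<open>log 2 0 = 0\<close> in HOL, whereas
  \<open>-log 0 = \<infinity>\<close> in the mathematical definition.
\<close>

definition seq_prob :: "('k \<Rightarrow> 'v) pmf \<Rightarrow> nat \<Rightarrow> 'k set \<Rightarrow> ('k \<Rightarrow> nat \<Rightarrow> 'v) \<Rightarrow> real" where
  "seq_prob P n J x = (\<Prod>i<n. pmf (marginal P J) (sub J (\<lambda>k. x k i)))"

definition typical :: "('k \<Rightarrow> 'v) pmf \<Rightarrow> 'k set \<Rightarrow> nat \<Rightarrow> real \<Rightarrow> ('k \<Rightarrow> nat \<Rightarrow> 'v) set" where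
  "typical P K n \<epsilon> =
     {x. \<forall>J. J \<subseteq> K \<and> J \<noteq> {} \<longrightarrow>
           seq_prob P n J x > 0 \<and>
           \<bar>- (1 / real n) * log 2 (seq_prob P n J x) - ent P J\<bar> \<le> \<epsilon>}"

text \<open>
  Given \<open>\<^bold>U = \<^bold>u\<close>, the \<open>i\<close>-th letter of all components is drawn, independently over \<open>i\<close>, from the
  joint law conditioned on \<open>U = u\<^sub>i\<close>; its \<open>V\<close>-components then have law \<open>p(v | u\<^sub>i)\<close>.  The
  conditioning event has positive probability whenever \<open>u\<close> is typical.
\<close>

definition cond_seq_law ::
  "('k \<Rightarrow> 'v) pmf \<Rightarrow> 'k set \<Rightarrow> nat \<Rightarrow> ('k \<Rightarrow> nat \<Rightarrow> 'v) \<Rightarrow> (nat \<Rightarrow> 'k \<Rightarrow> 'v) pmf" where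
  "cond_seq_law P U n u =
     Pi_pmf {..<n} undefined (\<lambda>i. cond_pmf P {x. sub U x = sub U (\<lambda>k. u k i)})"

definition B_typical ::
  "('k \<Rightarrow> 'v) pmf \<Rightarrow> 'k set \<Rightarrow> 'k set \<Rightarrow> nat \<Rightarrow> real \<Rightarrow> ('k \<Rightarrow> nat \<Rightarrow> 'v) set" where
  "B_typical P V U n \<epsilon> =
     {u \<in> typical P U n \<epsilon>.
        measure_pmf.prob (cond_seq_law P U n u)
          {v. (\<lambda>k i. if k \<in> U then u k i else v i k) \<in> typical P (U \<union> V) n \<epsilon>} \<ge> 1 - \<epsilon>}"


section \<open>The random variables \<open>B\<^sub>1, \<dots>, B\<^sub>m, S, Y\<close>\<close>

text \<open>
  Bit positions are the elements of a finite type \<open>'m\<close> with \<open>m = CARD('m) \<ge> 1\<close>, so that \<open>{0,1}\<^sup>m\<close> is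
  the type \<open>'m \<Rightarrow> bool\<close>.
\<close>

datatype 'm rv = Bit 'm | Sign | Out

datatype 'y val = BitVal bool | SignVal int | OutVal 'y

instance rv :: (finite) finite
proof
  have "(UNIV :: 'a rv set) = range Bit \<union> {Sign, Out}"
    by (auto intro: rv.exhaust)
  then show "finite (UNIV :: 'a rv set)"
    by (metis finite.emptyI finite.insertI finite_UnI finite_imageI finite)
qed

instance val :: (countable) countable
  by countable_datatype

abbreviation Bits :: "'m rv set" where
  "Bits \<equiv> range Bit"

fun letter :: "('m \<Rightarrow> bool) \<Rightarrow> int \<Rightarrow> 'y \<Rightarrow> 'm rv \<Rightarrow> 'y val" where
  "letter b s y (Bit j) = BitVal (b j)"
| "letter b s y Sign = SignVal s"
| "letter b s y Out = OutVal y"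

definition seqs ::
  "('m \<Rightarrow> nat \<Rightarrow> bool) \<Rightarrow> (nat \<Rightarrow> int) \<Rightarrow> (nat \<Rightarrow> 'y) \<Rightarrow> 'm rv \<Rightarrow> nat \<Rightarrow> 'y val" where
  "seqs b s y = (\<lambda>k i. letter (\<lambda>j. b j i) (s i) (y i) k)"

definition ask :: "nat \<Rightarrow> int set" where
  "ask M = (\<lambda>k. 2 * int k + 1 - int M) ` {..<M}"

definition amplitudes :: "nat \<Rightarrow> int set" where
  "amplitudes M = (\<lambda>k. 2 * int k + 1) ` {..<M div 2}"

definition signs :: "int set" where
  "signs = {-1, 1}"

text \<open>
  A channel is a function \<open>W :: int \<Rightarrow> 'y pmf\<close>; by the following lemma only its values on the input
  alphabet \<open>ask M\<close> are ever used below.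
\<close>

lemma sign_mult_amplitude_in_ask:
  assumes "even M" "s \<in> signs" "a \<in> amplitudes M"
  shows "s * a \<in> ask M"
proof -
  obtain h where M: "M = 2 * h" using assms(1) by blast
  obtain k where k: "k < h" "a = 2 * int k + 1" using assms(3) M by (auto simp: amplitudes_def)
  have "1 * a \<in> ask M"
    unfolding ask_def using k M by (intro image_eqI[of _ _ "h + k"]) auto
  moreover have "-1 * a \<in> ask M"
    unfolding ask_def using k M by (intro image_eqI[of _ _ "h - 1 - k"]) (auto simp: of_nat_diff)
  ultimately show ?thesis using assms(2) by (auto simp: signs_def)
qed

definition joint_law ::
  "(int \<Rightarrow> 'y pmf) \<Rightarrow> (('m \<Rightarrow> bool) \<Rightarrow> int) \<Rightarrow> ('m \<Rightarrow> bool) pmf \<Rightarrow> ('m rv \<Rightarrow> 'y val) pmf" where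
  "joint_law W f p =
     do {
       b \<leftarrow> p;
       s \<leftarrow> pmf_of_set signs;
       y \<leftarrow> W (s * f b);
       return_pmf (letter b s y)
     }"

definition R_BMD ::
  "(int \<Rightarrow> 'y pmf) \<Rightarrow> (('m::finite \<Rightarrow> bool) \<Rightarrow> int) \<Rightarrow> ('m \<Rightarrow> bool) pmf \<Rightarrow> real" where
  "R_BMD W f p =
     (let P = joint_law W f p
      in ent P (insert Sign Bits) - cond_ent P {Sign} {Out} - (\<Sum>i\<in>UNIV. cond_ent P {Bit i} {Out}))"


section \<open>Basic sign-coding with bit-metric decoding\<close>

text \<open>
  Sequences that form part of a code are extensional on \<open>{..<n}\<close>, so that injectivity of the map
  from messages to codewords refers to genuine length-\<open>n\<close> sequences.  An unused argument of
  \<open>seqs\<close> is left \<open>undefined\<close>.  As the map from messages to amplitude sequences is injective, a sign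
  sequence that depends on the message is the same as one that depends on the amplitude sequence.
\<close>

definition sign_encoder ::
  "(int \<Rightarrow> 'y pmf) \<Rightarrow> (('m \<Rightarrow> bool) \<Rightarrow> int) \<Rightarrow> ('m \<Rightarrow> bool) pmf \<Rightarrow> real \<Rightarrow> nat \<Rightarrow> nat \<Rightarrow>
   (nat \<Rightarrow> 'm \<Rightarrow> nat \<Rightarrow> bool) \<Rightarrow> (nat \<Rightarrow> nat \<Rightarrow> int) \<Rightarrow> bool" where
  "sign_encoder W f p \<epsilon> n M\<^sub>a b s \<longleftrightarrow>
     \<epsilon> > 0 \<and> M\<^sub>a \<ge> 1 \<and> inj_on b {1..M\<^sub>a} \<and>
     (\<forall>m\<in>{1..M\<^sub>a}.
        (\<forall>j. b m j \<in> {..<n} \<rightarrow>\<^sub>E UNIV) \<and>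
        seqs (b m) undefined undefined \<in> B_typical (joint_law W f p) {Sign, Out} Bits n \<epsilon> \<and>
        s m \<in> {..<n} \<rightarrow>\<^sub>E signs)"

definition amplitude_seq ::
  "(('m \<Rightarrow> bool) \<Rightarrow> int) \<Rightarrow> ('m \<Rightarrow> nat \<Rightarrow> bool) \<Rightarrow> nat \<Rightarrow> int" where
  "amplitude_seq f b = (\<lambda>i. f (\<lambda>j. b j i))"

definition channel_seq :: "(int \<Rightarrow> 'y pmf) \<Rightarrow> nat \<Rightarrow> (nat \<Rightarrow> int) \<Rightarrow> (nat \<Rightarrow> 'y) pmf" where
  "channel_seq W n x = Pi_pmf {..<n} undefined (\<lambda>i. W (x i))"

definition BMD_match ::
  "('m rv \<Rightarrow> 'y val) pmf \<Rightarrow> real \<Rightarrow> nat \<Rightarrow> ('m \<Rightarrow> nat \<Rightarrow> bool) \<Rightarrow> (nat \<Rightarrow> int) \<Rightarrow> (nat \<Rightarrow> 'y) \<Rightarrow> bool"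
where
  "BMD_match P \<epsilon> n b s y \<longleftrightarrow>
     seqs undefined s y \<in> typical P {Sign, Out} n \<epsilon> \<and>
     (\<forall>j. seqs b undefined y \<in> typical P {Bit j, Out} n \<epsilon>)"

definition BMD_decode ::
  "('m rv \<Rightarrow> 'y val) pmf \<Rightarrow> real \<Rightarrow> nat \<Rightarrow> nat \<Rightarrow>
   (nat \<Rightarrow> 'm \<Rightarrow> nat \<Rightarrow> bool) \<Rightarrow> (nat \<Rightarrow> nat \<Rightarrow> int) \<Rightarrow> (nat \<Rightarrow> 'y) \<Rightarrow> nat option" where
  "BMD_decode P \<epsilon> n M\<^sub>a b s y =
     (if \<exists>!m. m \<in> {1..M\<^sub>a} \<and> BMD_match P \<epsilon> n (b m) (s m) y
      then Some (THE m. m \<in> {1..M\<^sub>a} \<and> BMD_match P \<epsilon> n (b m) (s m) y)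
      else None)"

definition error_prob ::
  "(int \<Rightarrow> 'y pmf) \<Rightarrow> (('m \<Rightarrow> bool) \<Rightarrow> int) \<Rightarrow> ('m \<Rightarrow> bool) pmf \<Rightarrow> real \<Rightarrow> nat \<Rightarrow> nat \<Rightarrow>
   (nat \<Rightarrow> 'm \<Rightarrow> nat \<Rightarrow> bool) \<Rightarrow> (nat \<Rightarrow> nat \<Rightarrow> int) \<Rightarrow> real" where
  "error_prob W f p \<epsilon> n M\<^sub>a b s =
     measure_pmf.prob
       (do {
          m \<leftarrow> pmf_of_set {1..M\<^sub>a};
          y \<leftarrow> channel_seq W n (\<lambda>i. amplitude_seq f (b m) i * s m i);
          return_pmf (m, y)
        })
       {(m, y). BMD_decode (joint_law W f p) \<epsilon> n M\<^sub>a b s y \<noteq> Some m}"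

definition achievable ::
  "(int \<Rightarrow> 'y pmf) \<Rightarrow> (('m \<Rightarrow> bool) \<Rightarrow> int) \<Rightarrow> real \<Rightarrow> bool" where
  "achievable W f R \<longleftrightarrow>
     (\<forall>\<delta>>0. \<forall>\<^sub>F n in sequentially. \<exists>p \<epsilon> M\<^sub>a M\<^sub>s b s.
        M\<^sub>s = (1::nat) \<and> sign_encoder W f p \<epsilon> n M\<^sub>a b s \<and>
        1 / real n * log 2 (real (M\<^sub>a * M\<^sub>s)) \<ge> R - \<delta> \<and>
        error_prob W f p \<epsilon> n M\<^sub>a b s \<le> \<delta>)"

end

theory Submission
  imports Defs "HOL-Probability.Hoeffding" "HOL-Real_Asymp.Real_Asymp"
begin

text \<open>
  Since \<open>H(S, B) = 1 + H(B)\<close>, the constraint \<open>H(B) \<le> R_BMD\<close> says precisely that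
  \<open>H(S|Y) + (\<Sum>j. H(B\<^sub>j|Y)) \<le> 1\<close>.

  Achievability: choose about \<open>2 powr (n * (H(B) - \<delta>))\<close> of the at least
  \<open>2 powr (n * (H(B) - \<epsilon>)) / 2\<close> many \<open>\<B>\<close>-typical bit sequences at random, with uniform sign
  sequences.  By \<open>\<B>\<close>-typicality the transmitted pair fails to match the output with probability at
  most \<open>\<epsilon>\<close>.  For any output, at most \<open>2 powr (n * (H(S|Y) + (\<Sum>j. H(B\<^sub>j|Y)) + O(\<epsilon>)))\<close> pairs of bit
  and sign sequences match; this is at most \<open>2 powr (n * (1 + O(\<epsilon>)))\<close>, and there are \<open>2 ^ n\<close> sign
  sequences, so a fixed competing message matches with probability about
  \<open>2 powr (- (n * (H(B) - O(\<epsilon>))))\<close>.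

  Existence of the maximum: the conditional entropies are sums of nonnegative terms that depend
  continuously on the distribution, so the constraint, being a condition on all finite partial sums,
  is closed in the probability simplex; point masses satisfy it.
\<close>


section \<open>Weak law of large numbers\<close>

text \<open>Over an infinite output alphabet only finiteness of the entropies is available. The
  log-probabilities are then integrable but may have infinite variance, so Chebyshev's inequality
  cannot give the law of large numbers; truncation does. The conditional entropies are handled as
  suprema of finite sums: lower semicontinuity already closes the constraint, while
  \<open>H(B)\<close> lives on a finite set and is continuous. In the coding part, the count of
  matching pairs holds for every single output sequence, so the output and a competing codeword need
  not be independent. The code must be one-to-one, so codewords are drawn without replacement; this
  leads to the ratio \<open>(M - 1) / (N - 1)\<close> in the error bound. The constant
  \<open>2 * (CARD('m) + 1) * \<epsilon>\<close> collects a loss of \<open>2 * \<epsilon>\<close> in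
  the exponent for each of the \<open>CARD('m) + 1\<close> decoding metrics:
  \<open>\<epsilon>\<close> from the joint law and \<open>\<epsilon>\<close> from the output
  law.\<close>

lemma hoeffding_Pi_pmf_avg:
  fixes X :: "'a \<Rightarrow> real"
  assumes bdd: "\<And>x. \<bar>X x\<bar> \<le> K" and K: "K > 0" and \<eta>: "\<eta> \<ge> 0" and n: "n > 0"
  shows "measure_pmf.prob (Pi_pmf {..<n} d (\<lambda>_. P))
           {\<omega>. \<bar>(\<Sum>i<n. X (\<omega> i)) / real n - measure_pmf.expectation P X\<bar> \<ge> \<eta>}
         \<le> 2 * exp (- \<eta>\<^sup>2 * real n / (2 * K\<^sup>2))"
proof -
  let ?Pn = "Pi_pmf {..<n} d (\<lambda>_. P)"
  have comp: "map_pmf (\<lambda>\<omega>. \<omega> i) ?Pn = P" if "i < n" for i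
    using that by (simp add: Pi_pmf_component)
  interpret indep_interval_bounded_random_variables "measure_pmf ?Pn" "{..<n}" "\<lambda>i \<omega>. X (\<omega> i)"
      "\<lambda>_. -K" "\<lambda>_. K"
  proof
    show "prob_space.indep_vars (measure_pmf ?Pn) (\<lambda>_. borel) (\<lambda>i \<omega>. X (\<omega> i)) {..<n}"
      by (intro prob_space.indep_vars_compose2[OF _ indep_vars_Pi_pmf])
         (auto simp: measure_pmf.prob_space_axioms)
  qed (use bdd in \<open>auto simp: abs_le_iff minus_le_iff\<close>)
  define \<mu> where "\<mu> = (\<Sum>i<n. measure_pmf.expectation ?Pn (\<lambda>\<omega>. X (\<omega> i)))"
  interpret Hoeffding_ineq "measure_pmf ?Pn" "{..<n}" "\<lambda>i \<omega>. X (\<omega> i)" "\<lambda>_. -K" "\<lambda>_. K" \<mu>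
    by unfold_locales (simp add: \<mu>_def)
  have "measure_pmf.expectation ?Pn (\<lambda>\<omega>. X (\<omega> i)) = measure_pmf.expectation P X" if "i < n" for i
    by (subst (2) comp[OF that, symmetric]) simp
  hence \<mu>: "\<mu> = real n * measure_pmf.expectation P X"
    by (simp add: \<mu>_def)
  have "measure_pmf.prob ?Pn {x \<in> space ?Pn. \<bar>(\<Sum>i<n. X (x i)) - \<mu>\<bar> \<ge> \<eta> * n}
          \<le> 2 * exp (-2 * (\<eta> * n)\<^sup>2 / (\<Sum>i<n. (K - - K)\<^sup>2))"
    using Hoeffding_ineq_abs_ge[of "\<eta> * n"]  \<eta> n K by auto
  also have "-2 * (\<eta> * n)\<^sup>2 / (\<Sum>i<n. (K - - K)\<^sup>2) = - \<eta>\<^sup>2 * real n / (2 * K\<^sup>2)"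
    using n K by (simp add: field_simps power2_eq_square)
  also have "{x \<in> space ?Pn. \<bar>(\<Sum>i<n. X (x i)) - \<mu>\<bar> \<ge> \<eta> * n} =
             {\<omega>. \<bar>(\<Sum>i<n. X (\<omega> i)) / real n - measure_pmf.expectation P X\<bar> \<ge> \<eta>}"
  proof -
    have "\<bar>x - \<mu>\<bar> \<ge> \<eta> * n \<longleftrightarrow> \<bar>x / real n - measure_pmf.expectation P X\<bar> \<ge> \<eta>" for x
    proof -
      have "x - \<mu> = n * (x / real n - measure_pmf.expectation P X)"
        using n by (simp add: \<mu> field_simps)
      hence "\<bar>x - \<mu>\<bar> = n * \<bar>x / real n - measure_pmf.expectation P X\<bar>"
        by (simp add: abs_mult)
      thus ?thesis using n by (simp add: mult.commute)
    qed
    thus ?thesis by auto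
  qed
  finally show ?thesis .
qed

text \<open>Meant for the unbounded tail left by truncation: its first moment is small, and the
  average of the \<open>\<bar>Z (\<omega> i)\<bar>\<close> has the same mean as a single
  \<open>\<bar>Z\<bar>\<close>.\<close>

lemma markov_Pi_pmf_avg:
  fixes Z :: "'a \<Rightarrow> real"
  assumes int: "integrable (measure_pmf P) Z" and \<eta>: "\<eta> > 0" and n: "n > 0"
  shows "measure_pmf.prob (Pi_pmf {..<n} d (\<lambda>_. P)) {\<omega>. \<bar>(\<Sum>i<n. Z (\<omega> i)) / real n\<bar> \<ge> \<eta>}
         \<le> measure_pmf.expectation P (\<lambda>x. \<bar>Z x\<bar>) / \<eta>"
proof -
  let ?Pn = "Pi_pmf {..<n} d (\<lambda>_. P)"
  have comp: "map_pmf (\<lambda>\<omega>. \<omega> i) ?Pn = P" if "i < n" for i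
    using that by (simp add: Pi_pmf_component)
  have int1: "integrable (measure_pmf ?Pn) (\<lambda>\<omega>. \<bar>Z (\<omega> i)\<bar>)" if "i < n" for i
  proof -
    have "integrable (map_pmf (\<lambda>\<omega>. \<omega> i) ?Pn) (\<lambda>x. \<bar>Z x\<bar>)"
      using int by (simp only: comp[OF that] integrable_abs)
    thus ?thesis by (simp add: integrable_distr_eq map_pmf_rep_eq)
  qed
  have exp1: "measure_pmf.expectation ?Pn (\<lambda>\<omega>. \<bar>Z (\<omega> i)\<bar>) = measure_pmf.expectation P (\<lambda>x. \<bar>Z x\<bar>)"
    if "i < n" for i
    by (subst (2) comp[OF that, symmetric]) simp
  let ?g = "\<lambda>\<omega>. (\<Sum>i<n. \<bar>Z (\<omega> i)\<bar>) / real n"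
  have intg: "integrable (measure_pmf ?Pn) ?g"
    using int1 by (intro integrable_divide Bochner_Integration.integrable_sum) auto
  have "measure_pmf.prob ?Pn {\<omega>. \<bar>(\<Sum>i<n. Z (\<omega> i)) / real n\<bar> \<ge> \<eta>} \<le> measure_pmf.prob ?Pn {\<omega>\<in>space ?Pn. ?g \<omega> \<ge> \<eta>}"
    using n by (intro measure_pmf.finite_measure_mono) (auto simp: abs_divide intro!: order_trans[OF _ divide_right_mono[OF sum_abs]])
  also have "\<dots> \<le> measure_pmf.expectation ?Pn ?g / \<eta>"
    using intg \<eta> by (intro integral_Markov_inequality_measure[where A="{}"]) (auto intro!: sum_nonneg divide_nonneg_nonneg)
  also have "measure_pmf.expectation ?Pn ?g = measure_pmf.expectation P (\<lambda>x. \<bar>Z x\<bar>)"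
    using n exp1 int1 by simp
  finally show ?thesis .
qed

lemma truncation_expectation_tendsto_0:
  fixes X :: "'a \<Rightarrow> real"
  assumes int: "integrable (measure_pmf P) X"
  shows "(\<lambda>k. measure_pmf.expectation P (\<lambda>x. \<bar>if \<bar>X x\<bar> \<le> real k then 0 else X x\<bar>)) \<longlonglongrightarrow> 0"
proof -
  have "(\<lambda>k. measure_pmf.expectation P (\<lambda>x. \<bar>if \<bar>X x\<bar> \<le> real k then 0 else X x\<bar>))
          \<longlonglongrightarrow> measure_pmf.expectation P (\<lambda>x. 0)"
  proof (rule integral_dominated_convergence[where w = "\<lambda>x. \<bar>X x\<bar>"])
    show "AE x in measure_pmf P. (\<lambda>k. \<bar>if \<bar>X x\<bar> \<le> real k then 0 else X x\<bar>) \<longlonglongrightarrow> 0"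
    proof (rule AE_I2)
      fix x
      obtain k0 where "\<bar>X x\<bar> \<le> real k0" using real_arch_simple by blast
      hence "\<bar>if \<bar>X x\<bar> \<le> real k then 0 else X x\<bar> = 0" if "k \<ge> k0" for k
        using that by auto
      hence "\<forall>\<^sub>F k in sequentially. \<bar>if \<bar>X x\<bar> \<le> real k then 0 else X x\<bar> = 0"
        by (rule eventually_sequentiallyI)
      thus "(\<lambda>k. \<bar>if \<bar>X x\<bar> \<le> real k then 0 else X x\<bar>) \<longlonglongrightarrow> 0"
        by (rule tendsto_eventually)
    qed
  qed (use int in auto)
  thus ?thesis by simp
qed

text \<open>\<open>X\<close> is split into a bounded part \<open>Y\<close>, treated by Hoeffding's
  inequality, and a tail \<open>Z\<close>, treated by Markov's inequality; the truncation level is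
  fixed before \<open>n\<close> grows.\<close>

proposition weak_law_of_large_numbers_Pi_pmf:
  fixes X :: "'a \<Rightarrow> real"
  assumes int: "integrable (measure_pmf P) X" and \<epsilon>: "\<epsilon> > 0"
  shows "(\<lambda>n. measure_pmf.prob (Pi_pmf {..<n} d (\<lambda>_. P))
           {\<omega>. \<bar>(\<Sum>i<n. X (\<omega> i)) / real n - measure_pmf.expectation P X\<bar> > \<epsilon>}) \<longlonglongrightarrow> 0"
proof (rule LIMSEQ_I)
  fix r :: real assume r: "r > 0"
  \<comment> \<open>The first bound keeps the mean of the tail below \<open>\<epsilon> / 3\<close>;
    the second makes Markov's bound at threshold \<open>\<epsilon> / 3\<close> equal to
    \<open>r / 4\<close>.\<close>
  define \<eta> where "\<eta> = min (\<epsilon> / 3) (\<epsilon> * r / 12)"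
  have \<eta>: "\<eta> > 0" using \<epsilon> r by (simp add: \<eta>_def)
  let ?Z = "\<lambda>k x. if \<bar>X x\<bar> \<le> real k then 0 else X x"
  from LIMSEQ_D[OF truncation_expectation_tendsto_0[OF int] \<eta>] obtain k0 where
    k0: "\<And>k. k \<ge> k0 \<Longrightarrow> \<bar>measure_pmf.expectation P (\<lambda>x. \<bar>?Z k x\<bar>)\<bar> < \<eta>" by auto
  \<comment> \<open>The successor makes the level positive, as the Hoeffding exponent divides by its
    square.\<close>
  define k where "k = Suc k0"
  define Z where "Z = ?Z k"
  define Y where "Y = (\<lambda>x. X x - Z x)"
  have Zm: "measure_pmf.expectation P (\<lambda>x. \<bar>Z x\<bar>) \<le> \<eta>"
    using k0[of k] by (simp add: Z_def k_def)
  have intZ: "integrable (measure_pmf P) Z"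
    by (rule Bochner_Integration.integrable_bound[OF int]) (auto simp: Z_def)
  have intY: "integrable (measure_pmf P) Y" using int intZ by (simp add: Y_def)
  have Ybd: "\<bar>Y x\<bar> \<le> real k" for x by (simp add: Y_def Z_def)
  have EX: "measure_pmf.expectation P X = measure_pmf.expectation P Y + measure_pmf.expectation P Z"
    using int intZ by (simp add: Y_def)
  have EZ: "\<bar>measure_pmf.expectation P Z\<bar> \<le> \<epsilon> / 3"
    by (rule order_trans[OF integral_abs_bound order_trans[OF Zm]]) (simp add: \<eta>_def)
  have lim: "(\<lambda>n. 2 * exp (- (\<epsilon>/3)\<^sup>2 * real n / (2 * (real k)\<^sup>2))) \<longlonglongrightarrow> 0"
  proof -
    have k: "real k > 0" by (simp add: k_def)
    define c where "c = (\<epsilon>/3)\<^sup>2 / (2 * (real k)\<^sup>2)"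
    have c: "c > 0" using \<epsilon> k by (simp add: c_def)
    have "(\<lambda>n. 2 * exp (- c * real n)) \<longlonglongrightarrow> 0" using c by real_asymp
    thus ?thesis by (simp add: c_def field_simps)
  qed
  from LIMSEQ_D[OF lim, of "r/2"] r obtain n0 where
    n0: "\<And>n. n \<ge> n0 \<Longrightarrow> 2 * exp (- (\<epsilon>/3)\<^sup>2 * real n / (2 * (real k)\<^sup>2)) < r/2" by auto
  show "\<exists>no. \<forall>n\<ge>no. norm (measure_pmf.prob (Pi_pmf {..<n} d (\<lambda>_. P))
           {\<omega>. \<bar>(\<Sum>i<n. X (\<omega> i)) / real n - measure_pmf.expectation P X\<bar> > \<epsilon>} - 0) < r"
  proof (intro exI[of _ "Suc n0"] allI impI)
    fix n assume n: "n \<ge> Suc n0"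
    let ?Pn = "Pi_pmf {..<n} d (\<lambda>_. P)"
    let ?A = "{\<omega>. \<bar>(\<Sum>i<n. Y (\<omega> i)) / real n - measure_pmf.expectation P Y\<bar> \<ge> \<epsilon> / 3}"
    let ?B = "{\<omega>. \<bar>(\<Sum>i<n. Z (\<omega> i)) / real n\<bar> \<ge> \<epsilon> / 3}"
    have "{\<omega>. \<bar>(\<Sum>i<n. X (\<omega> i)) / real n - measure_pmf.expectation P X\<bar> > \<epsilon>} \<subseteq> ?A \<union> ?B"
    proof
      fix \<omega> assume "\<omega> \<in> {\<omega>. \<bar>(\<Sum>i<n. X (\<omega> i)) / real n - measure_pmf.expectation P X\<bar> > \<epsilon>}"
      moreover have "(\<Sum>i<n. X (\<omega> i)) = (\<Sum>i<n. Y (\<omega> i)) + (\<Sum>i<n. Z (\<omega> i))"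
        by (simp add: Y_def sum_subtractf)
      ultimately have "\<epsilon> < \<bar>((\<Sum>i<n. Y (\<omega> i)) / n - measure_pmf.expectation P Y) + (\<Sum>i<n. Z (\<omega> i)) / n
           - measure_pmf.expectation P Z\<bar>"
        by (simp add: EX add_divide_distrib algebra_simps)
      moreover have "\<epsilon> / 3 \<le> \<bar>u\<bar> \<or> \<epsilon> / 3 \<le> \<bar>v\<bar>"
        if "\<epsilon> < \<bar>u + v - w\<bar>" "\<bar>w\<bar> \<le> \<epsilon> / 3" for u v w :: real
        using that by linarith
      ultimately show "\<omega> \<in> ?A \<union> ?B" using EZ by blast
    qed
    hence "measure_pmf.prob ?Pn {\<omega>. \<bar>(\<Sum>i<n. X (\<omega> i)) / real n - measure_pmf.expectation P X\<bar> > \<epsilon>}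
            \<le> measure_pmf.prob ?Pn (?A \<union> ?B)"
      by (intro measure_pmf.finite_measure_mono) auto
    also have "\<dots> \<le> measure_pmf.prob ?Pn ?A + measure_pmf.prob ?Pn ?B"
      by (rule measure_Un_le) auto
    also have "measure_pmf.prob ?Pn ?A \<le> 2 * exp (- (\<epsilon>/3)\<^sup>2 * real n / (2 * (real k)\<^sup>2))"
      by (rule hoeffding_Pi_pmf_avg) (use Ybd n \<epsilon> in \<open>auto simp: k_def\<close>)
    also have "\<dots> < r / 2" using n by (intro n0) auto
    also have "measure_pmf.prob ?Pn ?B \<le> measure_pmf.expectation P (\<lambda>x. \<bar>Z x\<bar>) / (\<epsilon> / 3)"
      by (rule markov_Pi_pmf_avg) (use intZ \<epsilon> n in auto)
    also have "\<dots> \<le> (\<epsilon> * r / 12) / (\<epsilon> / 3)"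
      using Zm \<epsilon> by (intro divide_right_mono) (auto simp: \<eta>_def)
    also have "\<dots> = r / 4" using \<epsilon> by simp
    finally show "norm (measure_pmf.prob ?Pn
           {\<omega>. \<bar>(\<Sum>i<n. X (\<omega> i)) / real n - measure_pmf.expectation P X\<bar> > \<epsilon>} - 0) < r"
      using r by (simp add: measure_nonneg)
  qed
qed


section \<open>Entropy and typical sequences\<close>

abbreviation log_pmf_marginal :: "('k \<Rightarrow> 'v) pmf \<Rightarrow> 'k set \<Rightarrow> ('k \<Rightarrow> 'v) \<Rightarrow> real" where
  "log_pmf_marginal P J x \<equiv> log 2 (pmf (marginal P J) (sub J x))"

lemma information_space_pmf: "information_space (measure_pmf P) 2"
  by (simp add: information_space_def information_space_axioms_def measure_pmf.prob_space_axioms)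

lemma distributed_map_pmf:
  "distributed (measure_pmf P) (count_space UNIV) X (\<lambda>z. ennreal (pmf (map_pmf X P) z))"
  using map_pmf_rep_eq[of X P] measure_pmf_eq_density[of "map_pmf X P"] by (simp add: distributed_def)

lemma integrable_map_pmf_weighted:
  fixes g :: "'b \<Rightarrow> real"
  assumes "integrable (count_space UNIV) (\<lambda>z. pmf (map_pmf X P) z * g z)"
  shows "integrable (measure_pmf P) (\<lambda>x. g (X x))"
    and "measure_pmf.expectation P (\<lambda>x. g (X x)) = (\<integral>z. pmf (map_pmf X P) z * g z \<partial>count_space UNIV)"
proof -
  have "integrable (map_pmf X P) g"
    unfolding measure_pmf_eq_density using assms by (subst integrable_real_density) auto
  thus "integrable (measure_pmf P) (\<lambda>x. g (X x))"
    by (simp add: integrable_distr_eq map_pmf_rep_eq)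
  have "measure_pmf.expectation P (\<lambda>x. g (X x)) = measure_pmf.expectation (map_pmf X P) g"
    by simp
  also have "\<dots> = (\<integral>z. pmf (map_pmf X P) z * g z \<partial>count_space UNIV)"
    unfolding measure_pmf_eq_density by (subst integral_density) auto
  finally show "measure_pmf.expectation P (\<lambda>x. g (X x)) = (\<integral>z. pmf (map_pmf X P) z * g z \<partial>count_space UNIV)" .
qed

lemma has_finite_entropy_integrable:
  assumes "has_finite_entropy P J"
  shows "integrable (measure_pmf P) (log_pmf_marginal P J)"
    and "integrable (count_space UNIV) (\<lambda>z. pmf (marginal P J) z * log 2 (pmf (marginal P J) z))"
proof -
  interpret information_space "measure_pmf P" 2 by (rule information_space_pmf)
  show *: "integrable (count_space UNIV) (\<lambda>z. pmf (marginal P J) z * log 2 (pmf (marginal P J) z))"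
    using assms finite_entropy_integrable unfolding has_finite_entropy_def by blast
  show "integrable (measure_pmf P) (log_pmf_marginal P J)"
    using integrable_map_pmf_weighted(1)[of "sub J" P "\<lambda>z. log 2 (pmf (marginal P J) z)"] * by (simp add: marginal_def)
qed

lemma ent_eq_expectation:
  assumes "has_finite_entropy P J"
  shows "ent P J = - measure_pmf.expectation P (log_pmf_marginal P J)"
proof -
  interpret information_space "measure_pmf P" 2 by (rule information_space_pmf)
  have "ent P J = - (\<integral>z. pmf (marginal P J) z * log 2 (pmf (marginal P J) z) \<partial>count_space UNIV)"
    unfolding ent_def marginal_def by (rule entropy_distr[OF distributed_map_pmf]) simp
  thus ?thesis
    using integrable_map_pmf_weighted(2)[of "sub J" P "\<lambda>z. log 2 (pmf (marginal P J) z)"]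
      has_finite_entropy_integrable(2)[OF assms] by (simp add: marginal_def)
qed

lemma pmf_marginal_mono:
  assumes "K \<subseteq> J"
  shows "pmf (marginal P J) z \<le> pmf (marginal P K) (sub K z)"
proof -
  have "sub K x = sub K z" if "sub J x = z" for x
    unfolding that[symmetric] using assms by (auto simp: restrict_def fun_eq_iff)
  thus ?thesis
    unfolding marginal_def pmf_map by (intro measure_pmf.finite_measure_mono) auto
qed

lemma pmf_marginal_pos: "x \<in> set_pmf P \<Longrightarrow> pmf (marginal P J) (sub J x) > 0"
  unfolding marginal_def by (rule pmf_positive) auto

text \<open>Two projections together determine the projection to the union and conversely; this
  links the pair law in the library's conditional entropy to \<open>marginal\<close>.\<close>

lemma pmf_map_pair_sub:
  "pmf (map_pmf (\<lambda>x. (sub J x, sub K x)) P) (sub J x, sub K x) = pmf (marginal P (J \<union> K)) (sub (J \<union> K) x)"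
proof -
  have "(\<lambda>x. (sub J x, sub K x)) -` {(sub J x, sub K x)} = sub (J \<union> K) -` {sub (J \<union> K) x}"
    by (auto simp: restrict_def fun_eq_iff) (metis+)
  thus ?thesis by (simp add: marginal_def pmf_map)
qed

text \<open>The chain rule. Countability makes the product of the two counting measures a counting
  measure, so that the library's integral becomes an expectation under \<open>P\<close>; on the
  support the logarithm of the quotient splits.\<close>

lemma cond_ent_eq:
  fixes P :: "('k \<Rightarrow> 'v) pmf"
  assumes fin: "has_finite_entropy P (J \<union> K)" "has_finite_entropy P K"
    and cnt: "countable (UNIV :: ('k \<Rightarrow> 'v) set)"
  shows "cond_ent P J K = ent P (J \<union> K) - ent P K"
proof -
  interpret information_space "measure_pmf P" 2 by (rule information_space_pmf)
  let ?C = "count_space (UNIV :: ('k \<Rightarrow> 'v) set)"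
  let ?Q = "map_pmf (\<lambda>x. (sub J x, sub K x)) P"
  let ?h = "\<lambda>z. log 2 (pmf ?Q z / pmf (marginal P K) (snd z))"
  have prod: "?C \<Otimes>\<^sub>M ?C = count_space UNIV"
    using pair_measure_countable[OF cnt cnt] by simp
  have sf: "sigma_finite_measure ?C"
    by (rule sigma_finite_measure_count_space_countable[OF cnt])
  have "cond_ent P J K = - (\<integral>(x, y). pmf ?Q (x, y) * log 2 (pmf ?Q (x, y) / pmf (marginal P K) y) \<partial>(?C \<Otimes>\<^sub>M ?C))"
    unfolding cond_ent_def marginal_def
    by (rule conditional_entropy_generic_eq[OF sf sf distributed_map_pmf])
       (auto simp: prod distributed_map_pmf)
  also have "\<dots> = - (\<integral>z. pmf ?Q z * ?h z \<partial>count_space UNIV)"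
    by (simp add: prod case_prod_unfold)
  also have "(\<integral>z. pmf ?Q z * ?h z \<partial>count_space UNIV) = measure_pmf.expectation ?Q ?h"
    unfolding measure_pmf_eq_density by (subst integral_density) auto
  also have "\<dots> = measure_pmf.expectation P (\<lambda>x. log_pmf_marginal P (J \<union> K) x - log_pmf_marginal P K x)"
    unfolding integral_map_pmf
    by (intro integral_cong_AE)
       (auto simp: AE_measure_pmf_iff pmf_map_pair_sub log_divide
         pmf_marginal_pos[THEN less_imp_neq, symmetric])
  also have "\<dots> = - ent P (J \<union> K) + ent P K"
    using fin by (simp add: ent_eq_expectation has_finite_entropy_integrable)
  finally show ?thesis by simp
qed

text \<open>This makes the \<open>undefined\<close> placeholders harmless: tuples with different
  fillers outside \<open>K\<close> or beyond \<open>n\<close> can be exchanged.\<close>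

lemma typical_cong:
  assumes "\<And>k i. k \<in> K \<Longrightarrow> i < n \<Longrightarrow> x k i = x' k i"
  shows "x \<in> typical P K n \<epsilon> \<longleftrightarrow> x' \<in> typical P K n \<epsilon>"
proof -
  have "seq_prob P n J x = seq_prob P n J x'" if "J \<subseteq> K" for J
    unfolding seq_prob_def using that assms
    by (intro prod.cong refl arg_cong[of _ _ "pmf _"]) (auto simp: restrict_def fun_eq_iff)
  thus ?thesis by (simp add: typical_def)
qed

lemma typical_subset: "x \<in> typical P K n \<epsilon> \<Longrightarrow> K' \<subseteq> K \<Longrightarrow> x \<in> typical P K' n \<epsilon>"
  by (auto simp: typical_def)

lemma typical_seq_prob_bounds:
  assumes "x \<in> typical P K n \<epsilon>" "J \<subseteq> K" "J \<noteq> {}" "n > 0"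
  shows "seq_prob P n J x \<le> 2 powr (- (real n * (ent P J - \<epsilon>)))"
    and "seq_prob P n J x \<ge> 2 powr (- (real n * (ent P J + \<epsilon>)))"
proof -
  define L where "L = log 2 (seq_prob P n J x)"
  have pos: "seq_prob P n J x > 0" and b: "\<bar>- (1 / real n) * L - ent P J\<bar> \<le> \<epsilon>"
    using assms by (auto simp: typical_def L_def)
  have eq: "seq_prob P n J x = 2 powr L" using pos by (simp add: L_def)
  have "L \<le> - (real n * (ent P J - \<epsilon>))" "L \<ge> - (real n * (ent P J + \<epsilon>))"
    using b assms(4) by (auto simp: abs_le_iff field_simps)
  thus "seq_prob P n J x \<le> 2 powr (- (real n * (ent P J - \<epsilon>)))"
    and "seq_prob P n J x \<ge> 2 powr (- (real n * (ent P J + \<epsilon>)))"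
    by (auto simp: eq)
qed

text \<open>For each \<open>J\<close> the logarithm of \<open>seq_prob\<close> is a sum of
  independent identically distributed terms, so the weak law applies; a union bound over the
  finitely many \<open>J\<close> finishes.\<close>

theorem asymptotic_equipartition:
  fixes P :: "('k::finite \<Rightarrow> 'v) pmf"
  assumes fin: "\<And>J. has_finite_entropy P J" and \<epsilon>: "\<epsilon> > 0"
  shows "(\<lambda>n. measure_pmf.prob (Pi_pmf {..<n} d (\<lambda>_. P)) {v. (\<lambda>k i. v i k) \<notin> typical P K n \<epsilon>}) \<longlonglongrightarrow> 0"
proof -
  define bad where "bad = (\<lambda>J n. {v :: nat \<Rightarrow> 'k \<Rightarrow> 'v.
    \<bar>(\<Sum>i<n. log_pmf_marginal P J (v i)) / real n - measure_pmf.expectation P (log_pmf_marginal P J)\<bar> > \<epsilon>})"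
  have lim: "(\<lambda>n. \<Sum>J\<in>Pow K - {{}}. measure_pmf.prob (Pi_pmf {..<n} d (\<lambda>_. P)) (bad J n)) \<longlonglongrightarrow> (\<Sum>J\<in>Pow K - {{}}. 0)"
    unfolding bad_def
    by (intro tendsto_sum weak_law_of_large_numbers_Pi_pmf has_finite_entropy_integrable fin \<epsilon>)
  have le: "measure_pmf.prob (Pi_pmf {..<n} d (\<lambda>_. P)) {v. (\<lambda>k i. v i k) \<notin> typical P K n \<epsilon>}
     \<le> (\<Sum>J\<in>Pow K - {{}}. measure_pmf.prob (Pi_pmf {..<n} d (\<lambda>_. P)) (bad J n))" for n
  proof -
    let ?Pn = "Pi_pmf {..<n} d (\<lambda>_. P)"
    \<comment> \<open>The restriction to the support is essential: \<open>typical\<close> demands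
      positive probability, and the logarithm of the product splits only when all factors are
      nonzero.\<close>
    have "(\<lambda>k i. v i k) \<in> typical P K n \<epsilon>"
      if v: "v \<in> set_pmf ?Pn" and nb: "v \<notin> (\<Union>J\<in>Pow K - {{}}. bad J n)" for v
      unfolding typical_def
    proof (intro CollectI allI impI)
      fix J assume J: "J \<subseteq> K \<and> J \<noteq> {}"
      have vP: "v i \<in> set_pmf P" if "i < n" for i
        using v that by (auto simp: set_Pi_pmf PiE_dflt_def)
      have pos: "pmf (marginal P J) (sub J (v i)) > 0" if "i < n" for i
        by (rule pmf_marginal_pos[OF vP[OF that]])
      have "log 2 (seq_prob P n J (\<lambda>k i. v i k)) = (\<Sum>i<n. log_pmf_marginal P J (v i))"
        unfolding seq_prob_def log_def sum_divide_distrib[symmetric] by (subst ln_prod) (auto simp: pos[THEN less_imp_neq, symmetric])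
      moreover have "v \<notin> bad J n" using nb J by auto
      ultimately show "0 < seq_prob P n J (\<lambda>k i. v i k) \<and>
          \<bar>- (1 / real n) * log 2 (seq_prob P n J (\<lambda>k i. v i k)) - ent P J\<bar> \<le> \<epsilon>"
        using pos by (auto simp: bad_def seq_prob_def ent_eq_expectation[OF fin] intro!: prod_pos)
    qed
    hence "measure_pmf.prob ?Pn {v. (\<lambda>k i. v i k) \<notin> typical P K n \<epsilon>}
             \<le> measure_pmf.prob ?Pn (\<Union>J\<in>Pow K - {{}}. bad J n)"
      by (intro measure_pmf.finite_measure_mono_AE) (auto simp: AE_measure_pmf_iff)
    also have "\<dots> \<le> (\<Sum>J\<in>Pow K - {{}}. measure_pmf.prob ?Pn (bad J n))"
      by (intro measure_UNION_le) auto
    finally show ?thesis .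
  qed
  have "(\<lambda>n. \<Sum>J\<in>Pow K - {{}}. measure_pmf.prob (Pi_pmf {..<n} d (\<lambda>_. P)) (bad J n)) \<longlonglongrightarrow> 0"
    using lim unfolding sum.neutral_const .
  thus ?thesis
    by (rule Lim_null_comparison[rotated]) (use le in \<open>simp add: measure_nonneg\<close>)
qed

lemma sum_pmf_le_prob:
  assumes "finite T" "T \<subseteq> E"
  shows "(\<Sum>x\<in>T. pmf p x) \<le> measure_pmf.prob p E"
  using assms by (simp add: measure_measure_pmf_finite[symmetric] measure_pmf.finite_measure_mono)

text \<open>The sequences jointly typical with a fixed \<open>y\<close> have disjoint contributions to the
  probability of \<open>y\<close>, each at least \<open>2 powr - (n * (ent P {u, w} + \<epsilon>))\<close>.\<close>
lemma card_conditionally_typical_le: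
  fixes P :: "('k \<Rightarrow> 'v) pmf" and x :: "'a \<Rightarrow> 'k \<Rightarrow> nat \<Rightarrow> 'v"
  assumes fin: "finite T" and n: "n > 0"
    and jt: "\<And>c. c \<in> T \<Longrightarrow> x c \<in> typical P {u, w} n \<epsilon>"
    and y: "\<And>c i. c \<in> T \<Longrightarrow> i < n \<Longrightarrow> x c w i = y i"
    and inj: "\<And>c c'. c \<in> T \<Longrightarrow> c' \<in> T \<Longrightarrow> (\<And>i. i < n \<Longrightarrow> x c u i = x c' u i) \<Longrightarrow> c = c'"
  shows "real (card T) \<le> 2 powr (real n * (ent P {u, w} - ent P {w} + 2 * \<epsilon>))"
proof (cases "T = {}")
  case False
  then obtain c0 where c0: "c0 \<in> T" by blast
  let ?M = "marginal P {u, w}"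
  let ?Pn = "Pi_pmf {..<n} undefined (\<lambda>_. ?M)"
  \<comment> \<open>Beyond \<open>n\<close> the value must be the default of \<open>?Pn\<close>,
    since otherwise the sequence would have mass 0.\<close>
  let ?z = "\<lambda>c i. if i < n then sub {u, w} (\<lambda>k. x c k i) else undefined"
  have zinj: "inj_on ?z T"
  proof (rule inj_onI)
    fix c c' assume c: "c \<in> T" "c' \<in> T" and eq: "?z c = ?z c'"
    have "x c u i = x c' u i" if "i < n" for i
      using fun_cong[OF fun_cong[OF eq, of i], of u] that by simp
    thus "c = c'" using inj c by blast
  qed
  have pz: "pmf ?Pn (?z c) = seq_prob P n {u, w} (x c)" for c
    by (subst pmf_Pi') (auto simp: seq_prob_def)
  have "card T * 2 powr (- (real n * (ent P {u, w} + \<epsilon>))) = (\<Sum>c\<in>T. 2 powr (- (real n * (ent P {u, w} + \<epsilon>))))"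
    by simp
  also have "\<dots> \<le> (\<Sum>c\<in>T. pmf ?Pn (?z c))"
    unfolding pz by (intro sum_mono typical_seq_prob_bounds(2)[OF jt]) (use n in auto)
  also have "\<dots> = (\<Sum>z\<in>?z ` T. pmf ?Pn z)"
    by (simp add: sum.reindex[OF zinj])
  \<comment> \<open>All candidates share their \<open>w\<close>-letters with \<open>c0\<close>, so
    they lie in the event that these letters occur, whose probability is the
    \<open>w\<close>-marginal one.\<close>
  also have "\<dots> \<le> measure_pmf.prob ?Pn (Pi {..<n} (\<lambda>i. {z. sub {w} z = sub {w} (\<lambda>k. x c0 k i)}))"
    using fin y c0 by (intro sum_pmf_le_prob) (auto simp: restrict_def fun_eq_iff)
  also have "\<dots> = (\<Prod>i<n. measure_pmf.prob ?M {z. sub {w} z = sub {w} (\<lambda>k. x c0 k i)})"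
    by (rule measure_Pi_pmf_Pi) simp
  also have "\<dots> = seq_prob P n {w} (x c0)"
  proof -
    have "sub {w} (sub {u, w} z) = sub {w} z" for z :: "'k \<Rightarrow> 'v" by (auto simp: restrict_def fun_eq_iff)
    hence "marginal P {w} = map_pmf (sub {w}) ?M" by (simp add: marginal_def pmf.map_comp o_def)
    thus ?thesis by (simp add: seq_prob_def pmf_map vimage_def)
  qed
  also have "\<dots> \<le> 2 powr (- (real n * (ent P {w} - \<epsilon>)))"
    by (rule typical_seq_prob_bounds(1)[OF jt[OF c0]]) (use n in auto)
  finally have "card T \<le> 2 powr (- (real n * (ent P {w} - \<epsilon>))) / 2 powr (- (real n * (ent P {u, w} + \<epsilon>)))"
    by (simp add: field_simps)
  also have "\<dots> = 2 powr (real n * (ent P {u, w} - ent P {w} + 2 * \<epsilon>))"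
    by (simp add: powr_diff[symmetric] algebra_simps)
  finally show ?thesis .
qed simp


section \<open>Selection of a code\<close>

text \<open>Double counting: an ordered pair of distinct elements survives the deletion of
  \<open>x\<close> for exactly \<open>card A - 2\<close> choices of \<open>x\<close>.\<close>

lemma sum_pairs_delete:
  fixes c :: "'a \<Rightarrow> 'a \<Rightarrow> real"
  assumes fin: "finite A" and card: "card A \<ge> 2"
  shows "(\<Sum>x\<in>A. \<Sum>a\<in>A - {x}. \<Sum>a'\<in>A - {x} - {a}. c a a')
           = (real (card A) - 2) * (\<Sum>a\<in>A. \<Sum>a'\<in>A - {a}. c a a')"
proof -
  \<comment> \<open>Padding with zeros makes the summation ranges independent of \<open>x\<close>,
    which allows the exchange of sums below.\<close>
  have inner: "(\<Sum>a\<in>A - {x}. \<Sum>a'\<in>A - {x} - {a}. c a a')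
      = (\<Sum>a\<in>A. \<Sum>a'\<in>A - {a}. if x \<in> A - {a, a'} then c a a' else 0)" if "x \<in> A" for x
  proof -
    have "(\<Sum>a'\<in>A - {x} - {a}. c a a') = (\<Sum>a'\<in>A - {a}. if x \<in> A - {a, a'} then c a a' else 0)"
      if "a \<in> A - {x}" for a
      using fin that \<open>x \<in> A\<close> by (intro sum.mono_neutral_cong_left) auto
    hence "(\<Sum>a\<in>A - {x}. \<Sum>a'\<in>A - {x} - {a}. c a a')
        = (\<Sum>a\<in>A - {x}. \<Sum>a'\<in>A - {a}. if x \<in> A - {a, a'} then c a a' else 0)"
      by (rule sum.cong[OF refl])
    also have "\<dots> = (\<Sum>a\<in>A. \<Sum>a'\<in>A - {a}. if x \<in> A - {a, a'} then c a a' else 0)"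
      using fin by (intro sum.mono_neutral_left) auto
    finally show ?thesis .
  qed
  have "(\<Sum>x\<in>A. \<Sum>a\<in>A - {x}. \<Sum>a'\<in>A - {x} - {a}. c a a')
      = (\<Sum>x\<in>A. \<Sum>a\<in>A. \<Sum>a'\<in>A - {a}. if x \<in> A - {a, a'} then c a a' else 0)"
    by (intro sum.cong refl inner)
  also have "\<dots> = (\<Sum>a\<in>A. \<Sum>x\<in>A. \<Sum>a'\<in>A - {a}. if x \<in> A - {a, a'} then c a a' else 0)"
    by (rule sum.swap)
  also have "\<dots> = (\<Sum>a\<in>A. \<Sum>a'\<in>A - {a}. \<Sum>x\<in>A. if x \<in> A - {a, a'} then c a a' else 0)"
    by (intro sum.cong refl sum.swap)
  also have "\<dots> = (\<Sum>a\<in>A. \<Sum>a'\<in>A - {a}. (real (card A) - 2) * c a a')"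
  proof (intro sum.cong refl)
    fix a a' assume a: "a \<in> A" "a' \<in> A - {a}"
    have "(\<Sum>x\<in>A. if x \<in> A - {a, a'} then c a a' else 0) = (\<Sum>x\<in>A - {a, a'}. c a a')"
      using fin by (intro sum.mono_neutral_cong_right) auto
    also have "\<dots> = real (card (A - {a, a'})) * c a a'" by simp
    also have "card (A - {a, a'}) = card A - 2"
      using a fin by (subst card_Diff_subset) auto
    finally show "(\<Sum>x\<in>A. if x \<in> A - {a, a'} then c a a' else 0) = (real (card A) - 2) * c a a'"
      using card by (simp add: of_nat_diff)
  qed
  finally show ?thesis by (simp add: sum_distrib_left)
qed

lemma exists_le_average:
  fixes f :: "'a \<Rightarrow> real"
  assumes "finite A" "A \<noteq> {}"
  shows "\<exists>x\<in>A. real (card A) * f x \<le> sum f A"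
proof (rule ccontr)
  assume "\<not> ?thesis"
  hence "(\<Sum>x\<in>A. sum f A) < (\<Sum>x\<in>A. real (card A) * f x)"
    using assms by (intro sum_strict_mono) auto
  thus False by (simp add: sum_distrib_left[symmetric])
qed

text \<open>Deleting an element with at least average contribution, one at a time, gives a subset
  which is no worse than a uniformly random one.\<close>
lemma exists_subset_pair_sum_le:
  fixes c :: "'a \<Rightarrow> 'a \<Rightarrow> real"
  assumes "finite A" "M \<le> card A"
  shows "\<exists>T\<subseteq>A. card T = M \<and>
    (\<Sum>a\<in>T. \<Sum>a'\<in>T - {a}. c a a') * (real (card A) * (real (card A) - 1))
      \<le> (\<Sum>a\<in>A. \<Sum>a'\<in>A - {a}. c a a') * (real M * (real M - 1))"
  using assms
proof (induction "card A - M" arbitrary: A)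
  case 0
  thus ?case by (intro exI[of _ A]) auto
next
  case (Suc d)
  let ?S = "\<lambda>A. \<Sum>a\<in>A. \<Sum>a'\<in>A - {a}. c a a'"
  let ?N = "real (card A)"
  have MN: "M < card A" using Suc.hyps(2) by linarith
  \<comment> \<open>The averaging step cancels the factor \<open>?N - 2\<close>. For at most two
    elements, \<open>M\<close> is 0 or 1, and a set of that size contains no pairs.\<close>
  show ?case
  proof (cases "card A \<le> 2")
    case True
    hence M: "M = 0 \<or> M = 1" using MN by linarith
    obtain T where T: "T \<subseteq> A" "card T = M" using obtain_subset_with_card_n[OF Suc.prems(2)] by blast
    have "finite T" using T Suc.prems finite_subset by blast
    hence "T = {} \<or> (\<exists>t. T = {t})" using M T(2) by (metis card_0_eq card_1_singletonE)
    hence S0: "?S T = 0" by auto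
    have M0: "real M * (real M - 1) = 0" using M by auto
    have "?S T * (?N * (?N - 1)) \<le> ?S A * (real M * (real M - 1))"
      unfolding S0 M0 by simp
    thus ?thesis using T by blast
  next
    case False
    have ne: "A \<noteq> {}" using False by auto
    \<comment> \<open>Some deletion leaves at most the average remaining sum, which is
      \<open>(?N - 2) / ?N\<close> times the full sum.\<close>
    obtain x where x: "x \<in> A" "?N * ?S (A - {x}) \<le> (\<Sum>x\<in>A. ?S (A - {x}))"
      using exists_le_average[OF Suc.prems(1) ne, of "\<lambda>x. ?S (A - {x})"] by auto
    have le: "?N * ?S (A - {x}) \<le> (?N - 2) * ?S A"
      using x(2) sum_pairs_delete[OF Suc.prems(1), of c] False by simp
    have c': "real (card (A - {x})) = ?N - 1" using x False by (simp add: of_nat_diff)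
    have card': "card (A - {x}) = card A - 1" using x by simp
    have "d = card (A - {x}) - M" "finite (A - {x})" "M \<le> card (A - {x})"
      using Suc.hyps(2) Suc.prems MN unfolding card' by auto
    from Suc.hyps(1)[OF this] obtain T where T: "T \<subseteq> A - {x}" "card T = M"
      "?S T * ((?N - 1) * (?N - 1 - 1)) \<le> ?S (A - {x}) * (real M * (real M - 1))"
      unfolding c' by blast
    have M0: "real M * (real M - 1) \<ge> 0" by (cases M) auto
    have "(?N - 2) * (?S T * (?N * (?N - 1))) = ?N * (?S T * ((?N - 1) * (?N - 1 - 1)))"
      by (simp add: algebra_simps)
    also have "\<dots> \<le> ?N * (?S (A - {x}) * (real M * (real M - 1)))"
      using T(3) by (intro mult_left_mono) auto
    also have "\<dots> = (?N * ?S (A - {x})) * (real M * (real M - 1))" by (simp only: mult.assoc)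
    also have "\<dots> \<le> ((?N - 2) * ?S A) * (real M * (real M - 1))"
      by (rule mult_right_mono[OF le M0])
    also have "\<dots> = (?N - 2) * (?S A * (real M * (real M - 1)))" by (simp only: mult.assoc)
    finally have "?S T * (?N * (?N - 1)) \<le> ?S A * (real M * (real M - 1))"
      using False by (subst (asm) mult_le_cancel_left_pos) auto
    thus ?thesis using T by blast
  qed
qed

text \<open>Signs of different codewords are independent. The union bound over competitors involves
  only two codewords at a time, so no larger joint law is needed.\<close>

lemma Pi_pmf_pair_component:
  assumes "finite T" "a \<in> T" "a' \<in> T" "a \<noteq> a'"
  shows "map_pmf (\<lambda>\<sigma>. (\<sigma> a, \<sigma> a')) (Pi_pmf T d p) = pair_pmf (p a) (p a')"
proof -
  have T: "T = insert a (T - {a})" using assms by auto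
  have "map_pmf (\<lambda>\<sigma>. (\<sigma> a, \<sigma> a')) (Pi_pmf T d p)
      = map_pmf (\<lambda>(y, h). (y, h a')) (pair_pmf (p a) (Pi_pmf (T - {a}) d p))"
    using assms by (subst T, subst Pi_pmf_insert) (auto simp: pmf.map_comp o_def case_prod_unfold)
  also have "\<dots> = pair_pmf (p a) (map_pmf (\<lambda>h. h a') (Pi_pmf (T - {a}) d p))"
    by (simp add: pair_map_pmf2 case_prod_unfold apsnd_def map_prod_def)
  also have "\<dots> = pair_pmf (p a) (p a')"
    using assms by (simp add: Pi_pmf_component)
  finally show ?thesis .
qed

lemma pair_pmf_of_set:
  assumes "finite A" "A \<noteq> {}" "finite B" "B \<noteq> {}"
  shows "pair_pmf (pmf_of_set A) (pmf_of_set B) = pmf_of_set (A \<times> B)"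
proof (intro pmf_eqI)
  fix x
  show "pmf (pair_pmf (pmf_of_set A) (pmf_of_set B)) x = pmf (pmf_of_set (A \<times> B)) x"
    using assms
    by (cases x) (simp add: pmf_pair card_cartesian_product indicator_def)
qed

lemma exists_le_expectation_pmf:
  fixes f :: "'a \<Rightarrow> real"
  assumes "finite (set_pmf p)"
  shows "\<exists>x\<in>set_pmf p. f x \<le> measure_pmf.expectation p f"
proof (rule ccontr)
  assume "\<not> ?thesis"
  hence lt: "\<forall>x\<in>set_pmf p. measure_pmf.expectation p f < f x" by auto
  have "measure_pmf.expectation p (\<lambda>_. measure_pmf.expectation p f) < measure_pmf.expectation p f"
    using assms lt
    by (intro measure_pmf.integral_less_AE_space)
       (auto simp: AE_measure_pmf_iff integrable_measure_pmf_finite)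
  thus False by simp
qed

text \<open>Random coding: \<open>a\<close> ranges over the candidate codewords and \<open>s\<close> over the sign sequences;
  \<open>F\<close> is the probability that the output does not match the transmitted pair, \<open>G\<close> the
  probability that it matches a competing pair.\<close>
lemma exists_good_labelled_subset:
  fixes C \<epsilon> :: real and F :: "'a \<Rightarrow> 's \<Rightarrow> real" and G :: "'a \<Rightarrow> 's \<Rightarrow> 'a \<Rightarrow> 's \<Rightarrow> real"
  assumes A: "finite A" "M \<le> card A" and S: "finite S" "S \<noteq> {}"
    and F: "\<And>a. a \<in> A \<Longrightarrow> (\<Sum>s\<in>S. F a s) \<le> \<epsilon> * card S"
    and G0: "\<And>a s a' s'. G a s a' s' \<ge> 0"
    and G: "\<And>a s. a \<in> A \<Longrightarrow> s \<in> S \<Longrightarrow> (\<Sum>a'\<in>A. \<Sum>s'\<in>S. G a s a' s') \<le> C * card S"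
  shows "\<exists>T \<sigma>. T \<subseteq> A \<and> card T = M \<and> \<sigma> \<in> T \<rightarrow> S \<and>
    (\<Sum>a\<in>T. F a (\<sigma> a) + (\<Sum>a'\<in>T - {a}. G a (\<sigma> a) a' (\<sigma> a')))
      \<le> M * (\<epsilon> + (real M - 1) * C / (real (card A) - 1))"
proof -
  define k where "k = real (card S)"
  have k: "k > 0" using S by (simp add: k_def card_gt_0_iff)
  define N where "N = real (card A)"
  \<comment> \<open>The probability of confusing \<open>a\<close> with \<open>a'\<close>, averaged
    over independent uniform signs for both. It is the pair cost for selecting \<open>T\<close>; the
    signs are fixed only afterwards.\<close>
  define c where "c a a' = (\<Sum>s\<in>S. \<Sum>s'\<in>S. G a s a' s') / k\<^sup>2" for a a'
  let ?S = "\<lambda>A. \<Sum>a\<in>A. \<Sum>a'\<in>A - {a}. c a a'"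
  obtain T where T: "T \<subseteq> A" "card T = M"
    and ST: "?S T * (N * (N - 1)) \<le> ?S A * (real M * (real M - 1))"
    using exists_subset_pair_sum_le[OF A, of c] unfolding N_def by blast
  have finT: "finite T" using T A finite_subset by blast
  have SA: "?S A \<le> N * C"
  proof -
    have "(\<Sum>a'\<in>A - {a}. c a a') \<le> C" if a: "a \<in> A" for a
    proof -
      have "(\<Sum>a'\<in>A - {a}. c a a') \<le> (\<Sum>a'\<in>A. c a a')"
        using A by (intro sum_mono2) (auto simp: c_def G0 intro!: divide_nonneg_nonneg sum_nonneg)
      also have "\<dots> = (\<Sum>s\<in>S. \<Sum>a'\<in>A. \<Sum>s'\<in>S. G a s a' s') / k\<^sup>2"
        unfolding c_def sum_divide_distrib[symmetric] by (subst sum.swap) simp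
      also have "\<dots> \<le> (\<Sum>s\<in>S. C * k) / k\<^sup>2"
        using G[OF a] by (intro divide_right_mono sum_mono) (auto simp: k_def)
      also have "\<dots> = C" using k by (simp add: k_def[symmetric] power2_eq_square)
      finally show ?thesis .
    qed
    hence "?S A \<le> (\<Sum>a\<in>A. C)" by (rule sum_mono)
    thus ?thesis by (simp add: N_def)
  qed
  have M0: "real M * (real M - 1) \<ge> 0" by (cases M) auto
  \<comment> \<open>With at most one candidate the denominator is not positive, but then both sides
    are 0 because there are no pairs.\<close>
  have ST': "?S T \<le> C * (real M * (real M - 1)) / (N - 1)"
  proof (cases "card A \<le> 1")
    case True
    hence "card T \<le> 1" using T A by linarith
    hence "T - {a} = {}" if "a \<in> T" for a using that finT by (auto simp: card_le_Suc0_iff_eq)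
    hence "(\<Sum>a'\<in>T - {a}. c a a') = 0" if "a \<in> T" for a using that by (simp only: sum.empty)
    hence "?S T = 0" by (simp only: sum.neutral_const cong: sum.cong)
    moreover have "real M * (real M - 1) = 0" using True A T by (cases M) auto
    ultimately show ?thesis by (metis div_0 mult_zero_right order_refl)
  next
    case False
    hence N: "N > 1" by (simp add: N_def)
    have "N * (?S T * (N - 1)) = ?S T * (N * (N - 1))" by (simp add: algebra_simps)
    also have "\<dots> \<le> N * C * (real M * (real M - 1))"
      by (rule order_trans[OF ST mult_right_mono[OF SA M0]])
    finally have "?S T * (N - 1) \<le> C * (real M * (real M - 1))"
      using N by (simp add: mult.assoc)
    thus ?thesis using N by (simp add: pos_le_divide_eq)
  qed
  define U where "U = pmf_of_set S"
  have U: "set_pmf U = S" using S by (simp add: U_def)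
  define R where "R = Pi_pmf T undefined (\<lambda>_. U)"
  have R: "set_pmf R = PiE_dflt T undefined (\<lambda>_. S)"
    using finT by (simp add: R_def set_Pi_pmf U)
  have finR: "finite (set_pmf R)" unfolding R using finT S by (intro finite_PiE_dflt) auto
  let ?tot = "\<lambda>\<sigma>. \<Sum>a\<in>T. F a (\<sigma> a) + (\<Sum>a'\<in>T - {a}. G a (\<sigma> a) a' (\<sigma> a'))"
  note int = integrable_measure_pmf_finite[OF finR]
  have EF: "measure_pmf.expectation R (\<lambda>\<sigma>. F a (\<sigma> a)) \<le> \<epsilon>" if a: "a \<in> T" for a
  proof -
    have "measure_pmf.expectation R (\<lambda>\<sigma>. F a (\<sigma> a)) = measure_pmf.expectation (map_pmf (\<lambda>\<sigma>. \<sigma> a) R) (F a)"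
      by simp
    also have "map_pmf (\<lambda>\<sigma>. \<sigma> a) R = U" using a finT by (simp add: R_def Pi_pmf_component)
    also have "measure_pmf.expectation U (F a) = (\<Sum>s\<in>S. F a s) / k"
      using S by (simp add: U_def integral_pmf_of_set k_def)
    also have "\<dots> \<le> \<epsilon>" using F[of a] a T k by (auto simp: k_def field_simps)
    finally show ?thesis .
  qed
  have EG: "measure_pmf.expectation R (\<lambda>\<sigma>. G a (\<sigma> a) a' (\<sigma> a')) = c a a'"
    if a: "a \<in> T" "a' \<in> T - {a}" for a a'
  proof -
    have "measure_pmf.expectation R (\<lambda>\<sigma>. G a (\<sigma> a) a' (\<sigma> a'))
        = measure_pmf.expectation (map_pmf (\<lambda>\<sigma>. (\<sigma> a, \<sigma> a')) R) (\<lambda>(s, s'). G a s a' s')"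
      by simp
    also have "map_pmf (\<lambda>\<sigma>. (\<sigma> a, \<sigma> a')) R = pair_pmf U U"
      unfolding R_def using a finT by (intro Pi_pmf_pair_component) auto
    also have "pair_pmf U U = pmf_of_set (S \<times> S)"
      unfolding U_def by (rule pair_pmf_of_set[OF S S])
    also have "measure_pmf.expectation \<dots> (\<lambda>(s, s'). G a s a' s') = c a a'"
      using S by (simp add: integral_pmf_of_set c_def k_def sum.cartesian_product card_cartesian_product power2_eq_square)
    finally show ?thesis .
  qed
  have "measure_pmf.expectation R ?tot
      = (\<Sum>a\<in>T. measure_pmf.expectation R (\<lambda>\<sigma>. F a (\<sigma> a))
          + (\<Sum>a'\<in>T - {a}. measure_pmf.expectation R (\<lambda>\<sigma>. G a (\<sigma> a) a' (\<sigma> a'))))"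
    by (simp add: int)
  also have "\<dots> \<le> (\<Sum>a\<in>T. \<epsilon> + (\<Sum>a'\<in>T - {a}. c a a'))"
    by (intro sum_mono add_mono EF) (auto simp: EG)
  also have "\<dots> = M * \<epsilon> + ?S T" by (simp add: sum.distrib T)
  finally have tot: "measure_pmf.expectation R ?tot \<le> M * \<epsilon> + ?S T" .
  obtain \<sigma> where \<sigma>: "\<sigma> \<in> set_pmf R" "?tot \<sigma> \<le> measure_pmf.expectation R ?tot"
    using exists_le_expectation_pmf[OF finR, of ?tot] by blast
  have "?tot \<sigma> \<le> M * \<epsilon> + C * (real M * (real M - 1)) / (N - 1)"
    using \<sigma>(2) tot ST' by linarith
  also have "\<dots> = M * (\<epsilon> + (real M - 1) * C / (N - 1))" by (simp add: algebra_simps)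
  finally have "?tot \<sigma> \<le> M * (\<epsilon> + (real M - 1) * C / (N - 1))" .
  moreover have "\<sigma> \<in> T \<rightarrow> S" using \<sigma>(1) by (auto simp: R PiE_dflt_def)
  ultimately show ?thesis using T unfolding N_def by blast
qed


section \<open>Bit-metric decoding of random sign codes\<close>

lemma measure_bind_pmf:
  "measure_pmf.prob (bind_pmf p K) E = measure_pmf.expectation p (\<lambda>x. measure_pmf.prob (K x) E)"
proof -
  \<comment> \<open>An event is the point \<open>True\<close> of a Boolean law, so the formula for
    point masses of a bind applies.\<close>
  have *: "measure_pmf.prob q E = pmf (map_pmf (\<lambda>x. x \<in> E) q) True" for q
    by (simp add: pmf_map vimage_def)
  show ?thesis unfolding * by (simp add: map_bind_pmf pmf_bind)
qed

lemma PiE_dflt_undefined: "PiE_dflt A undefined B = PiE A B"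
  by (auto simp: PiE_dflt_def PiE_def extensional_def)

text \<open>The conditional law of a letter given its bits. It does not depend on \<open>p\<close>,
  so \<open>joint_law\<close> is a mixture with weights \<open>p\<close>, hence linear in
  \<open>p\<close>.\<close>

definition letter_law :: "(int \<Rightarrow> 'y pmf) \<Rightarrow> (('m \<Rightarrow> bool) \<Rightarrow> int) \<Rightarrow> ('m \<Rightarrow> bool) \<Rightarrow> ('m rv \<Rightarrow> 'y val) pmf" where
  "letter_law W f b = do {
     s \<leftarrow> pmf_of_set signs;
     y \<leftarrow> W (s * f b);
     return_pmf (letter b s y)
   }"

lemma joint_law_eq: "joint_law W f p = bind_pmf p (letter_law W f)"
  by (simp add: joint_law_def letter_law_def[abs_def])

lemma signs_facts: "finite signs" "signs \<noteq> {}" "card signs = 2"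
  by (auto simp: signs_def)

lemma set_letter_lawD:
  "x \<in> set_pmf (letter_law W f b) \<Longrightarrow> \<exists>s\<in>signs. \<exists>y. x = letter b s y"
  by (auto simp: letter_law_def signs_facts)

definition bits_val :: "('m \<Rightarrow> bool) \<Rightarrow> 'm rv \<Rightarrow> 'y val" where
  "bits_val b = sub Bits (letter b undefined undefined)"

lemma sub_Bits_letter: "sub Bits (letter b s y) = bits_val b"
  by (auto simp: bits_val_def restrict_def fun_eq_iff)

lemma bits_val_inject: "bits_val b = bits_val b' \<longleftrightarrow> b = b'"
proof
  assume eq: "bits_val b = bits_val b'"
  show "b = b'"
  proof
    fix j show "b j = b' j" using fun_cong[OF eq, of "Bit j"] by (simp add: bits_val_def)
  qed
qed simp

lemma marginal_joint_law_Bits: "marginal (joint_law W f p) Bits = map_pmf bits_val p"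
proof -
  have "map_pmf (sub Bits) (letter_law W f b) = return_pmf (bits_val b)" for b
    by (simp add: letter_law_def map_bind_pmf sub_Bits_letter)
  thus ?thesis
    by (simp add: marginal_def joint_law_eq map_bind_pmf) (simp add: map_pmf_def)
qed

lemma pmf_marginal_joint_law_Bits: "pmf (marginal (joint_law W f p) Bits) (bits_val b) = pmf p b"
  unfolding marginal_joint_law_Bits by (rule pmf_map_inj') (simp add: inj_def bits_val_inject)

text \<open>A letter reveals its bits, so on the conditioning event only the component
  \<open>b\<close> of the mixture contributes; its weight \<open>pmf p b\<close> is the probability
  of the event and cancels.\<close>

lemma cond_pmf_joint_law:
  fixes W :: "int \<Rightarrow> 'y pmf" and p :: "('m \<Rightarrow> bool) pmf"
  assumes b: "b \<in> set_pmf p"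
  shows "cond_pmf (joint_law W f p) {x. sub Bits x = bits_val b} = letter_law W f b"
proof (rule pmf_eqI)
  fix x :: "'m rv \<Rightarrow> 'y val"
  let ?P = "joint_law W f p" and ?E = "{x :: 'm rv \<Rightarrow> 'y val. sub Bits x = bits_val b}"
  have E: "x \<in> ?E \<longleftrightarrow> b' = b" if "x \<in> set_pmf (letter_law W f b')" for x b'
    using set_letter_lawD[OF that] by (auto simp: sub_Bits_letter bits_val_inject)
  have "set_pmf (letter_law W f b) \<subseteq> set_pmf ?P \<inter> ?E"
    using b E by (auto simp: joint_law_eq)
  moreover have "set_pmf (letter_law W f b) \<noteq> {}" by (rule set_pmf_not_empty)
  ultimately have ne: "set_pmf ?P \<inter> ?E \<noteq> {}" by blast
  have mE: "measure_pmf.prob ?P ?E = pmf p b"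
    using pmf_marginal_joint_law_Bits[of W f p b] by (simp add: marginal_def pmf_map vimage_def)
  show "pmf (cond_pmf ?P ?E) x = pmf (letter_law W f b) x"
  proof (cases "x \<in> ?E")
    case True
    have eq: "pmf (letter_law W f b') x = pmf (letter_law W f b) x * indicator {b} b'" for b'
    proof (cases "b' = b")
      case False
      hence "x \<notin> set_pmf (letter_law W f b')" using E True by blast
      thus ?thesis using False by (simp add: set_pmf_iff)
    qed simp
    have "pmf ?P x = measure_pmf.expectation p (\<lambda>b'. pmf (letter_law W f b) x * indicator {b} b')"
      unfolding joint_law_eq pmf_bind by (rule Bochner_Integration.integral_cong[OF refl eq])
    also have "\<dots> = pmf (letter_law W f b) x * pmf p b"
      by (simp add: measure_pmf_single)
    finally have "pmf ?P x = pmf (letter_law W f b) x * pmf p b" .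
    moreover have "pmf p b > 0" using b by (simp add: pmf_positive)
    ultimately show ?thesis using True by (simp add: pmf_cond[OF ne] mE)
  next
    case False
    hence "x \<notin> set_pmf (letter_law W f b)" using E by blast
    thus ?thesis using False by (simp add: pmf_cond[OF ne] set_pmf_eq)
  qed
qed

lemma seqs_simps [simp]:
  "seqs b s y (Bit j) i = BitVal (b j i)" "seqs b s y Sign i = SignVal (s i)" "seqs b s y Out i = OutVal (y i)"
  by (simp_all add: seqs_def)

lemma cond_seq_law_joint_law:
  assumes "\<And>i. i < n \<Longrightarrow> (\<lambda>j. b j i) \<in> set_pmf p"
  shows "cond_seq_law (joint_law W f p) Bits n (seqs b s y) =
           Pi_pmf {..<n} undefined (\<lambda>i. letter_law W f (\<lambda>j. b j i))"
  unfolding cond_seq_law_def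
proof (intro Pi_pmf_cong refl)
  fix i assume "i \<in> {..<n}"
  moreover have "sub Bits (\<lambda>k. seqs b s y k i) = bits_val (\<lambda>j. b j i)"
    by (simp add: seqs_def sub_Bits_letter)
  ultimately show "cond_pmf (joint_law W f p) {x. sub Bits x = sub Bits (\<lambda>k. seqs b s y k i)}
        = letter_law W f (\<lambda>j. b j i)"
    using cond_pmf_joint_law[OF assms] by simp
qed

text \<open>The bridge between \<open>\<B>\<close>-typicality and random coding: drawing signs and
  outputs letter by letter amounts to a uniform sign sequence sent over the channel, so the
  conditional probability in \<open>B_typical\<close> is an average over the sign sequences of the
  code.\<close>

lemma Pi_pmf_letter_law:
  "Pi_pmf {..<n} undefined (\<lambda>i. letter_law W f (\<lambda>j. b j i)) = do {
     s \<leftarrow> pmf_of_set ({..<n} \<rightarrow>\<^sub>E signs);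
     map_pmf (\<lambda>y i. if i < n then letter (\<lambda>j. b j i) (s i) (y i) else undefined)
       (channel_seq W n (\<lambda>i. amplitude_seq f b i * s i))
   }"
proof -
  have signs: "Pi_pmf {..<n} undefined (\<lambda>_. pmf_of_set signs) = pmf_of_set ({..<n} \<rightarrow>\<^sub>E signs)"
    by (simp add: Pi_pmf_of_set signs_facts PiE_dflt_undefined)
  show ?thesis
    unfolding letter_law_def signs[symmetric] channel_seq_def amplitude_seq_def map_pmf_def
    by (subst Pi_pmf_bind[where d' = undefined], simp, intro bind_pmf_cong refl,
        subst Pi_pmf_bind[where d' = undefined]) (simp_all add: mult.commute)
qed

lemma card_sign_seqs: "card ({..<n} \<rightarrow>\<^sub>E signs) = 2 ^ n"
  by (simp add: card_PiE signs_facts)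

lemma sign_seqs_finite: "finite ({..<n::nat} \<rightarrow>\<^sub>E signs)" "({..<n} \<rightarrow>\<^sub>E signs) \<noteq> {}"
  by (auto intro!: finite_PiE simp: signs_facts PiE_eq_empty_iff)

lemma pmf_marginal_pos_of_typical:
  assumes "x \<in> typical P K n \<epsilon>" "J \<subseteq> K" "J \<noteq> {}" "i < n"
  shows "pmf (marginal P J) (sub J (\<lambda>k. x k i)) > 0"
proof -
  have "seq_prob P n J x > 0" using assms by (simp add: typical_def)
  hence "pmf (marginal P J) (sub J (\<lambda>k. x k i)) \<noteq> 0"
    using assms(4) unfolding seq_prob_def by (metis (no_types, lifting) finite_lessThan lessThan_iff less_irrefl prod_zero_iff)
  thus ?thesis by (simp add: order_less_le)
qed

text \<open>Typicality of the full tuple passes to subsets of its components, hence implies every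
  test of the decoder; \<open>\<B>\<close>-typicality bounds its failure on average over the
  signs.\<close>

lemma sum_no_match_le:
  fixes W :: "int \<Rightarrow> 'y pmf" and f :: "('m::finite \<Rightarrow> bool) \<Rightarrow> int" and p :: "('m \<Rightarrow> bool) pmf"
  defines "P \<equiv> joint_law W f p"
  assumes B: "seqs b undefined undefined \<in> B_typical P {Sign, Out} Bits n \<epsilon>"
  shows "(\<Sum>s\<in>{..<n} \<rightarrow>\<^sub>E signs. measure_pmf.prob (channel_seq W n (\<lambda>i. amplitude_seq f b i * s i))
            {y. \<not> BMD_match P \<epsilon> n b s y}) \<le> \<epsilon> * card ({..<n} \<rightarrow>\<^sub>E signs)"
proof -
  let ?S = "{..<n} \<rightarrow>\<^sub>E signs"
  let ?ch = "\<lambda>s. channel_seq W n (\<lambda>i. amplitude_seq f b i * s i)"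
  let ?u = "seqs b undefined undefined :: 'm rv \<Rightarrow> nat \<Rightarrow> 'y val"
  have jt: "?u \<in> typical P Bits n \<epsilon>" using B by (simp add: B_typical_def)
  \<comment> \<open>A typical sequence has positive probability, so every letter lies in the support
    and conditioning on it is legitimate.\<close>
  have bp: "(\<lambda>j. b j i) \<in> set_pmf p" if "i < n" for i
    using pmf_marginal_pos_of_typical[OF jt order_refl _ that]
    by (simp add: P_def seqs_def sub_Bits_letter pmf_marginal_joint_law_Bits set_pmf_iff)
  let ?E = "{v. (\<lambda>k i. if k \<in> Bits then ?u k i else v i k) \<in> typical P (Bits \<union> {Sign, Out}) n \<epsilon>}"
  have "1 - \<epsilon> \<le> measure_pmf.prob (cond_seq_law P Bits n ?u) ?E"
    using B by (simp add: B_typical_def)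
  also have "\<dots> = measure_pmf.expectation (pmf_of_set ?S) (\<lambda>s. measure_pmf.prob (?ch s)
       {y. (\<lambda>i. if i < n then letter (\<lambda>j. b j i) (s i) (y i) else undefined) \<in> ?E})"
    unfolding P_def
    by (subst cond_seq_law_joint_law[OF bp])
       (simp_all only: Pi_pmf_letter_law measure_bind_pmf measure_map_pmf vimage_def)
  also have "\<dots> \<le> measure_pmf.expectation (pmf_of_set ?S) (\<lambda>s. measure_pmf.prob (?ch s) {y. BMD_match P \<epsilon> n b s y})"
  proof (intro integral_mono integrable_measure_pmf_finite measure_pmf.finite_measure_mono subsetI CollectI)
    fix s y
    assume "y \<in> {y. (\<lambda>i. if i < n then letter (\<lambda>j. b j i) (s i) (y i) else undefined) \<in> ?E}"
    hence x: "(\<lambda>k i. if k \<in> Bits then ?u k i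
               else (if i < n then letter (\<lambda>j. b j i) (s i) (y i) else undefined) k)
            \<in> typical P (Bits \<union> {Sign, Out}) n \<epsilon>" (is "?x \<in> _") by simp
    have "seqs undefined s y \<in> typical P {Sign, Out} n \<epsilon>"
      by (subst typical_cong[where x' = ?x]) (auto intro: typical_subset[OF x])
    moreover have "seqs b undefined y \<in> typical P {Bit j, Out} n \<epsilon>" for j
      by (subst typical_cong[where x' = ?x]) (auto intro: typical_subset[OF x])
    ultimately show "BMD_match P \<epsilon> n b s y" by (simp add: BMD_match_def)
  qed (simp_all add: sign_seqs_finite)
  also have "\<dots> = (\<Sum>s\<in>?S. measure_pmf.prob (?ch s) {y. BMD_match P \<epsilon> n b s y}) / card ?S"
    by (rule integral_pmf_of_set) (rule sign_seqs_finite)+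
  finally have le: "(1 - \<epsilon>) * card ?S \<le> (\<Sum>s\<in>?S. measure_pmf.prob (?ch s) {y. BMD_match P \<epsilon> n b s y})"
    by (simp add: card_sign_seqs field_simps)
  have compl: "measure_pmf.prob (?ch s) {y. \<not> BMD_match P \<epsilon> n b s y}
      = 1 - measure_pmf.prob (?ch s) {y. BMD_match P \<epsilon> n b s y}" for s
    using measure_pmf.prob_compl[of "{y. BMD_match P \<epsilon> n b s y}" "?ch s"] by (simp add: Collect_neg_eq Compl_eq_Diff_UNIV)
  show ?thesis unfolding compl sum_subtractf using le by (simp add: left_diff_distrib)
qed

text \<open>This is \<open>H(S|Y) + (\<Sum>j. H(B\<^sub>j|Y))\<close>, with the conditional
  entropies as differences of joint ones, the form produced by counting.\<close>

definition match_entropy :: "('m::finite rv \<Rightarrow> 'y val) pmf \<Rightarrow> real" where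
  "match_entropy P = (ent P {Sign, Out} - ent P {Out}) + (\<Sum>j\<in>UNIV. ent P {Bit j, Out} - ent P {Out})"

text \<open>For a fixed output the decoder tests the sign and each bit level separately, so the
  matching pairs lie in a product of \<open>CARD('m) + 1\<close> sets, each counted as conditionally
  typical sequences.\<close>

lemma card_matching_le:
  fixes P :: "('m::finite rv \<Rightarrow> 'y val) pmf"
  assumes n: "n > 0" and A: "A \<subseteq> {b. \<forall>j. b j \<in> {..<n} \<rightarrow>\<^sub>E UNIV}"
  shows "real (card {(b, s). b \<in> A \<and> s \<in> {..<n} \<rightarrow>\<^sub>E signs \<and> BMD_match P \<epsilon> n b s y})
      \<le> 2 powr (real n * (match_entropy P + 2 * (real CARD('m) + 1) * \<epsilon>))"
proof -
  define TS where "TS = {s \<in> {..<n} \<rightarrow>\<^sub>E signs. seqs undefined s y \<in> typical P {Sign, Out} n \<epsilon>}"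
  \<comment> \<open>The bit tuple has \<open>c\<close> at every level; only level \<open>j\<close>
    is inspected.\<close>
  define TB where "TB j = {c \<in> {..<n} \<rightarrow>\<^sub>E (UNIV::bool set). seqs (\<lambda>_. c) undefined y \<in> typical P {Bit j, Out} n \<epsilon>}" for j
  have fin: "finite TS" "finite (TB j)" for j
    by (simp_all add: TS_def TB_def finite_PiE signs_facts)
  have "{(b, s). b \<in> A \<and> s \<in> {..<n} \<rightarrow>\<^sub>E signs \<and> BMD_match P \<epsilon> n b s y} \<subseteq> PiE UNIV TB \<times> TS"
  proof clarify
    fix b s assume b: "b \<in> A" and s: "s \<in> {..<n} \<rightarrow>\<^sub>E signs" and m: "BMD_match P \<epsilon> n b s y"
    have "seqs (\<lambda>_. b j) undefined y \<in> typical P {Bit j, Out} n \<epsilon>" for j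
      by (subst typical_cong[where x' = "seqs b undefined y"]) (use m in \<open>auto simp: BMD_match_def\<close>)
    moreover have "b j \<in> {..<n} \<rightarrow>\<^sub>E UNIV" for j using A b by blast
    ultimately show "b \<in> PiE UNIV TB \<and> s \<in> TS" using s m by (auto simp: TS_def TB_def BMD_match_def)
  qed
  hence "card {(b, s). b \<in> A \<and> s \<in> {..<n} \<rightarrow>\<^sub>E signs \<and> BMD_match P \<epsilon> n b s y} \<le> card (PiE UNIV TB \<times> TS)"
    using fin by (intro card_mono) (auto simp: finite_PiE)
  hence "real (card {(b, s). b \<in> A \<and> s \<in> {..<n} \<rightarrow>\<^sub>E signs \<and> BMD_match P \<epsilon> n b s y})
      \<le> (\<Prod>j\<in>UNIV. real (card (TB j))) * real (card TS)"
    by (simp add: card_cartesian_product card_PiE flip: of_nat_prod of_nat_mult)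
  also have "\<dots> \<le> (\<Prod>j\<in>UNIV. 2 powr (real n * (ent P {Bit j, Out} - ent P {Out} + 2 * \<epsilon>)))
        * 2 powr (real n * (ent P {Sign, Out} - ent P {Out} + 2 * \<epsilon>))"
  proof (intro mult_mono prod_mono conjI)
    show "real (card TS) \<le> 2 powr (real n * (ent P {Sign, Out} - ent P {Out} + 2 * \<epsilon>))"
    proof (rule card_conditionally_typical_le[where x = "\<lambda>s. seqs undefined s y" and y = "\<lambda>i. OutVal (y i)"])
      fix s s' assume s: "s \<in> TS" "s' \<in> TS"
        and eq: "\<And>i. i < n \<Longrightarrow> seqs undefined s y Sign i = seqs undefined s' y Sign i"
      show "s = s'"
        using s eq by (intro PiE_ext[of s "{..<n}" "\<lambda>_. signs" s']) (auto simp: TS_def)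
    qed (use n fin in \<open>auto simp: TS_def\<close>)
    show "real (card (TB j)) \<le> 2 powr (real n * (ent P {Bit j, Out} - ent P {Out} + 2 * \<epsilon>))" for j
    proof (rule card_conditionally_typical_le[where x = "\<lambda>c. seqs (\<lambda>_. c) undefined y" and y = "\<lambda>i. OutVal (y i)"])
      fix c c' assume c: "c \<in> TB j" "c' \<in> TB j"
        and eq: "\<And>i. i < n \<Longrightarrow> seqs (\<lambda>_. c) undefined y (Bit j) i = seqs (\<lambda>_. c') undefined y (Bit j) i"
      show "c = c'"
        using c eq by (intro PiE_ext[of c "{..<n}" "\<lambda>_. UNIV" c']) (auto simp: TB_def)
    qed (use n fin in \<open>auto simp: TB_def\<close>)
  qed (auto intro!: prod_nonneg)
  also have "\<dots> = 2 powr ((\<Sum>j\<in>UNIV. real n * (ent P {Bit j, Out} - ent P {Out} + 2 * \<epsilon>))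
        + real n * (ent P {Sign, Out} - ent P {Out} + 2 * \<epsilon>))"
    by (simp add: powr_sum powr_add)
  also have "(\<Sum>j\<in>UNIV. real n * (ent P {Bit j, Out} - ent P {Out} + 2 * \<epsilon>))
      = real n * ((\<Sum>j\<in>UNIV. ent P {Bit j, Out} - ent P {Out}) + real CARD('m) * (2 * \<epsilon>))"
    unfolding sum_distrib_left[symmetric] sum.distrib by simp
  also have "\<dots> + real n * (ent P {Sign, Out} - ent P {Out} + 2 * \<epsilon>)
      = real n * (match_entropy P + 2 * (real CARD('m) + 1) * \<epsilon>)"
    unfolding match_entropy_def by (simp only: algebra_simps)
  finally show ?thesis .
qed

text \<open>The sum is the expected number of matching pairs under \<open>R\<close>, and that number
  is bounded for every output; hence \<open>R\<close> can be the output law of any transmitted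
  codeword.\<close>

lemma sum_prob_match_le:
  fixes P :: "('m::finite rv \<Rightarrow> 'y val) pmf"
  assumes n: "n > 0" and A: "A \<subseteq> {b. \<forall>j. b j \<in> {..<n} \<rightarrow>\<^sub>E UNIV}" and finA: "finite A"
    and H: "match_entropy P \<le> 1"
  shows "(\<Sum>b\<in>A. \<Sum>s\<in>{..<n} \<rightarrow>\<^sub>E signs. measure_pmf.prob R {y. BMD_match P \<epsilon> n b s y})
      \<le> 2 powr (real n * (2 * (real CARD('m) + 1) * \<epsilon>)) * card ({..<n} \<rightarrow>\<^sub>E signs)"
proof -
  let ?S = "{..<n} \<rightarrow>\<^sub>E signs"
  let ?B = "2 powr (real n * (2 * (real CARD('m) + 1) * \<epsilon>)) * card ?S"
  let ?Q = "\<lambda>y. {(b, s). b \<in> A \<and> s \<in> ?S \<and> BMD_match P \<epsilon> n b s y}"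
  have bound: "real (card (?Q y)) \<le> ?B" for y
  proof -
    have "real (card (?Q y)) \<le> 2 powr (real n * (match_entropy P + 2 * (real CARD('m) + 1) * \<epsilon>))"
      by (rule card_matching_le[OF n A])
    \<comment> \<open>The entropy constraint enters here: the remaining \<open>2 powr n\<close> is
      exactly the number of sign sequences.\<close>
    also have "\<dots> \<le> 2 powr (real n * (1 + 2 * (real CARD('m) + 1) * \<epsilon>))"
      using H by (intro powr_mono mult_left_mono) auto
    also have "\<dots> = ?B"
      by (simp add: card_sign_seqs distrib_left powr_add powr_realpow)
    finally show ?thesis .
  qed
  have "(\<Sum>b\<in>A. \<Sum>s\<in>?S. measure_pmf.prob R {y. BMD_match P \<epsilon> n b s y})
      = (\<Sum>(b, s)\<in>A \<times> ?S. measure_pmf.expectation R (indicator {y. BMD_match P \<epsilon> n b s y}))"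
    by (simp add: sum.cartesian_product)
  also have "\<dots> = measure_pmf.expectation R (\<lambda>y. \<Sum>(b, s)\<in>A \<times> ?S. indicator {y. BMD_match P \<epsilon> n b s y} y)"
    unfolding case_prod_unfold
    by (rule Bochner_Integration.integral_sum[symmetric]) (rule measure_pmf.integrable_const_bound[where B = 1]; simp add: indicator_def)
  also have "\<dots> = measure_pmf.expectation R (\<lambda>y. real (card (?Q y)))"
  proof (rule arg_cong[of _ _ "measure_pmf.expectation R"], rule ext)
    fix y
    have fin: "finite (A \<times> ?S)" using finA sign_seqs_finite(1) by (rule finite_cartesian_product)
    have "(\<Sum>(b, s)\<in>A \<times> ?S. indicator {y. BMD_match P \<epsilon> n b s y} y)
        = (\<Sum>z\<in>A \<times> ?S. if z \<in> ?Q y then 1 else 0 :: real)"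
      by (rule sum.cong[OF refl]) (simp only: mem_Sigma_iff split_paired_all indicator_def mem_Collect_eq prod.case simp_thms of_bool_def)
    also have "\<dots> = (\<Sum>z\<in>(A \<times> ?S) \<inter> ?Q y. 1)"
      by (rule sum.inter_restrict[OF fin, symmetric])
    also have "(A \<times> ?S) \<inter> ?Q y = ?Q y" by blast
    finally show "(\<Sum>(b, s)\<in>A \<times> ?S. indicator {y. BMD_match P \<epsilon> n b s y} y) = real (card (?Q y))"
      by simp
  qed
  also have "\<dots> \<le> measure_pmf.expectation R (\<lambda>_. ?B)"
  proof (rule integral_mono)
    show "integrable (measure_pmf R) (\<lambda>y. real (card (?Q y)))"
      using bound by (intro measure_pmf.integrable_const_bound[where B = ?B]) simp_all
  qed (use bound in simp_all)
  also have "\<dots> = ?B" by simp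
  finally show ?thesis .
qed


section \<open>Number of admissible codewords and assembly of the code\<close>

definition codewords ::
  "(int \<Rightarrow> 'y pmf) \<Rightarrow> (('m \<Rightarrow> bool) \<Rightarrow> int) \<Rightarrow> ('m \<Rightarrow> bool) pmf \<Rightarrow> real \<Rightarrow> nat \<Rightarrow> ('m \<Rightarrow> nat \<Rightarrow> bool) set" where
  "codewords W f p \<epsilon> n = {b. (\<forall>j. b j \<in> {..<n} \<rightarrow>\<^sub>E UNIV) \<and>
     seqs b undefined undefined \<in> B_typical (joint_law W f p) {Sign, Out} Bits n \<epsilon>}"

lemma finite_codewords: "finite (codewords W f (p :: ('m::finite \<Rightarrow> bool) pmf) \<epsilon> n)"
proof (rule finite_subset)
  show "codewords W f p \<epsilon> n \<subseteq> PiE UNIV (\<lambda>_. {..<n} \<rightarrow>\<^sub>E UNIV)"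
    by (auto simp: codewords_def)
qed (intro finite_PiE; simp)

text \<open>By Markov's inequality over the bits, an overall atypicality of
  \<open>\<epsilon> / 2\<close> leaves probability at least one half for the bit sequences whose
  conditional atypicality is below \<open>\<epsilon>\<close>. Each of these has probability at most
  \<open>2 powr - (n * (H(B) - \<epsilon>))\<close>, so there must be many.\<close>

lemma card_codewords_ge:
  fixes W :: "int \<Rightarrow> 'y pmf" and f :: "('m::finite \<Rightarrow> bool) \<Rightarrow> int" and p :: "('m \<Rightarrow> bool) pmf"
  defines "P \<equiv> joint_law W f p"
  assumes \<epsilon>: "0 < \<epsilon>" "\<epsilon> < 1" and n: "n > 0"
    and atypical: "measure_pmf.prob (Pi_pmf {..<n} undefined (\<lambda>_. P))
      {v. (\<lambda>k i. v i k) \<notin> typical P (Bits \<union> {Sign, Out}) n \<epsilon>} \<le> \<epsilon> / 2"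
  shows "real (card (codewords W f p \<epsilon> n)) \<ge> 2 powr (real n * (ent P Bits - \<epsilon>)) / 2"
proof -
  let ?K = "Bits \<union> {Sign, Out} :: 'm rv set"
  define R where "R = Pi_pmf {..<n} (\<lambda>_. undefined) (\<lambda>_. p)"
  define Q where "Q \<beta> = Pi_pmf {..<n} undefined (\<lambda>i. letter_law W f (\<beta> i))" for \<beta>
  \<comment> \<open>The conditional probability of an atypical tuple given the bits; its mean over
    \<open>R\<close> is the total atypicality.\<close>
  define \<psi> where "\<psi> \<beta> = measure_pmf.prob (Q \<beta>) {v. (\<lambda>k i. v i k) \<notin> typical P ?K n \<epsilon>}" for \<beta>
  define tr where "tr \<beta> = (\<lambda>j i. \<beta> i j)" for \<beta> :: "nat \<Rightarrow> 'm \<Rightarrow> bool"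
  let ?u = "\<lambda>\<beta>. seqs (tr \<beta>) undefined undefined :: 'm rv \<Rightarrow> nat \<Rightarrow> 'y val"
  have setR: "set_pmf R = PiE_dflt {..<n} (\<lambda>_. undefined) (\<lambda>_. set_pmf p)"
    by (simp add: R_def set_Pi_pmf)
  have finR: "finite (set_pmf R)" unfolding setR by (intro finite_PiE_dflt) auto
  have "Pi_pmf {..<n} undefined (\<lambda>_. P) = bind_pmf R Q"
    unfolding P_def joint_law_eq R_def Q_def[abs_def] by (rule Pi_pmf_bind) simp
  hence E\<psi>: "measure_pmf.expectation R \<psi> \<le> \<epsilon> / 2"
    using atypical by (simp add: measure_bind_pmf \<psi>_def[abs_def])
  have "measure_pmf.prob R {\<beta> \<in> space R. \<psi> \<beta> \<ge> \<epsilon>} \<le> measure_pmf.expectation R \<psi> / \<epsilon>"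
    using \<epsilon> by (intro integral_Markov_inequality_measure[where A = "{}"] integrable_measure_pmf_finite finR)
      (auto simp: \<psi>_def)
  also have "\<dots> \<le> 1 / 2" using E\<psi> \<epsilon> by (simp add: field_simps)
  finally have markov: "measure_pmf.prob R {\<beta>. \<psi> \<beta> \<ge> \<epsilon>} \<le> 1 / 2" by simp
  define D where "D = {\<beta> \<in> set_pmf R. \<psi> \<beta> < \<epsilon>}"
  have finD: "finite D" using finR by (simp add: D_def)
  have D: "tr \<beta> \<in> codewords W f p \<epsilon> n \<and> pmf R \<beta> \<le> 2 powr (- (real n * (ent P Bits - \<epsilon>)))"
    if "\<beta> \<in> D" for \<beta>
  proof -
    have \<beta>: "\<beta> \<in> PiE_dflt {..<n} (\<lambda>_. undefined) (\<lambda>_. set_pmf p)" and \<psi>: "\<psi> \<beta> < \<epsilon>"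
      using that by (auto simp: D_def setR)
    have \<beta>p: "\<beta> i \<in> set_pmf p" if "i < n" for i using \<beta> that by (auto simp: PiE_dflt_def)
    have law: "cond_seq_law P Bits n (?u \<beta>) = Q \<beta>"
      unfolding P_def Q_def by (subst cond_seq_law_joint_law) (auto simp: tr_def \<beta>p)
    let ?x = "\<lambda>v k i. if k \<in> Bits then ?u \<beta> k i else v i k"
    \<comment> \<open>Almost surely the bits inside \<open>v\<close> are those of
      \<open>\<beta>\<close>, so overwriting them with \<open>?u \<beta>\<close> as in
      \<open>B_typical\<close> changes nothing.\<close>
    have same: "?x v \<in> typical P ?K n \<epsilon> \<longleftrightarrow> (\<lambda>k i. v i k) \<in> typical P ?K n \<epsilon>"
      if v: "v \<in> set_pmf (Q \<beta>)" for v
    proof (rule typical_cong)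
      fix k i assume i: "i < n"
      have "v i \<in> set_pmf (letter_law W f (\<beta> i))"
        using v i by (auto simp: Q_def set_Pi_pmf PiE_dflt_def)
      then obtain s y where "v i = letter (\<beta> i) s y" using set_letter_lawD by blast
      thus "?x v k i = v i k" by (auto simp: tr_def)
    qed
    have "1 - \<epsilon> \<le> 1 - \<psi> \<beta>" using \<psi> by simp
    also have "\<dots> = measure_pmf.prob (Q \<beta>) {v. (\<lambda>k i. v i k) \<in> typical P ?K n \<epsilon>}"
      unfolding \<psi>_def
      using measure_pmf.prob_compl[of "{v. (\<lambda>k i. v i k) \<in> typical P ?K n \<epsilon>}" "Q \<beta>"]
      by (simp add: Collect_neg_eq Compl_eq_Diff_UNIV)
    also have "\<dots> = measure_pmf.prob (Q \<beta>) {v. ?x v \<in> typical P ?K n \<epsilon>}"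
    proof (rule measure_pmf.finite_measure_eq_AE)
      show "AE v in Q \<beta>. v \<in> {v. (\<lambda>k i. v i k) \<in> typical P ?K n \<epsilon>} \<longleftrightarrow> v \<in> {v. ?x v \<in> typical P ?K n \<epsilon>}"
        unfolding AE_measure_pmf_iff mem_Collect_eq using same by blast
    qed simp_all
    finally have ge: "1 - \<epsilon> \<le> measure_pmf.prob (Q \<beta>) {v. ?x v \<in> typical P ?K n \<epsilon>}" .
    \<comment> \<open>Positive probability yields at least one typical extension of the bits, and
      its restriction shows that the bits themselves are typical.\<close>
    hence "measure_pmf.prob (Q \<beta>) {v. ?x v \<in> typical P ?K n \<epsilon>} \<noteq> 0" using \<epsilon> by linarith
    hence "{v. ?x v \<in> typical P ?K n \<epsilon>} \<noteq> {}" by (metis measure_empty)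
    then obtain v where "?x v \<in> typical P ?K n \<epsilon>" by blast
    hence "?x v \<in> typical P Bits n \<epsilon>" by (rule typical_subset[OF _ Un_upper1])
    hence jt: "?u \<beta> \<in> typical P Bits n \<epsilon>" by (subst (asm) typical_cong[where x' = "?u \<beta>"]) auto
    have "?u \<beta> \<in> B_typical P {Sign, Out} Bits n \<epsilon>"
      using jt ge by (simp add: B_typical_def law)
    moreover have "tr \<beta> j \<in> {..<n} \<rightarrow>\<^sub>E UNIV" for j
      using \<beta> by (auto simp: tr_def PiE_dflt_def PiE_def extensional_def)
    ultimately have "tr \<beta> \<in> codewords W f p \<epsilon> n" by (simp add: codewords_def P_def)
    moreover have "pmf R \<beta> = seq_prob P n Bits (?u \<beta>)"
    proof -
      have "pmf R \<beta> = (\<Prod>i<n. pmf p (\<beta> i))"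
        unfolding R_def using \<beta> by (subst pmf_Pi') (auto simp: PiE_dflt_def)
      also have "\<dots> = seq_prob P n Bits (?u \<beta>)"
        unfolding seq_prob_def P_def
        by (intro prod.cong refl) (simp add: seqs_def tr_def sub_Bits_letter pmf_marginal_joint_law_Bits)
      finally show ?thesis .
    qed
    ultimately show ?thesis using typical_seq_prob_bounds(1)[OF jt order_refl _ n] by simp
  qed
  have "1 / 2 \<le> measure_pmf.prob R (- {\<beta>. \<psi> \<beta> \<ge> \<epsilon>})"
    using markov measure_pmf.prob_compl[of "{\<beta>. \<psi> \<beta> \<ge> \<epsilon>}" R] by (simp add: Compl_eq_Diff_UNIV)
  also have "\<dots> \<le> measure_pmf.prob R D"
    by (intro measure_pmf.finite_measure_mono_AE) (auto simp: AE_measure_pmf_iff D_def not_le)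
  also have "\<dots> = (\<Sum>\<beta>\<in>D. pmf R \<beta>)" using finD by (rule measure_measure_pmf_finite)
  also have "\<dots> \<le> (\<Sum>\<beta>\<in>D. 2 powr (- (real n * (ent P Bits - \<epsilon>))))"
    using D by (intro sum_mono) blast
  also have "\<dots> = card D * 2 powr (- (real n * (ent P Bits - \<epsilon>)))" by simp
  also have "card D \<le> card (codewords W f p \<epsilon> n)"
  proof (rule card_inj_on_le)
    show "inj_on tr D" by (rule inj_onI) (auto simp: tr_def fun_eq_iff)
    show "tr ` D \<subseteq> codewords W f p \<epsilon> n" using D by blast
  qed (rule finite_codewords)
  finally have "1 / 2 \<le> real (card (codewords W f p \<epsilon> n)) * 2 powr (- (real n * (ent P Bits - \<epsilon>)))"
    by simp
  moreover have "2 powr x / 2 \<le> N" if "1 / 2 \<le> N * 2 powr (- x)" for N x :: real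
    using that by (simp add: powr_minus field_simps)
  ultimately show ?thesis by blast
qed

text \<open>The decoder can fail only if the sent message does not match or another one does; the
  union bound is then averaged over the messages.\<close>

lemma error_prob_le:
  fixes W :: "int \<Rightarrow> 'y pmf"
  defines "ch \<equiv> \<lambda>n f b s. channel_seq W n (\<lambda>i. amplitude_seq f b i * s i)"
  assumes M: "M \<ge> 1"
  shows "error_prob W f p \<epsilon> n M b s \<le> (\<Sum>m\<in>{1..M}.
      measure_pmf.prob (ch n f (b m) (s m)) {y. \<not> BMD_match (joint_law W f p) \<epsilon> n (b m) (s m) y}
      + (\<Sum>m'\<in>{1..M} - {m}. measure_pmf.prob (ch n f (b m) (s m)) {y. BMD_match (joint_law W f p) \<epsilon> n (b m') (s m') y}))
      / M"
proof -
  let ?match = "\<lambda>m y. BMD_match (joint_law W f p) \<epsilon> n (b m) (s m) y"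
  let ?dec = "BMD_decode (joint_law W f p) \<epsilon> n M b s"
  let ?ch = "\<lambda>m. ch n f (b m) (s m)"
  have dec: "?dec y = Some m" if "m \<in> {1..M}" "?match m y" "\<forall>m'\<in>{1..M} - {m}. \<not> ?match m' y" for m y
  proof -
    have "m' \<in> {1..M} \<and> ?match m' y \<longleftrightarrow> m' = m" for m' using that by blast
    thus ?thesis by (simp add: BMD_decode_def)
  qed
  have "measure_pmf.prob (?ch m) {y. ?dec y \<noteq> Some m}
      \<le> measure_pmf.prob (?ch m) {y. \<not> ?match m y} + (\<Sum>m'\<in>{1..M} - {m}. measure_pmf.prob (?ch m) {y. ?match m' y})"
    if m: "m \<in> {1..M}" for m
  proof -
    have "{y. ?dec y \<noteq> Some m} \<subseteq> {y. \<not> ?match m y} \<union> (\<Union>m'\<in>{1..M} - {m}. {y. ?match m' y})"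
      using dec[OF m] by blast
    hence "measure_pmf.prob (?ch m) {y. ?dec y \<noteq> Some m}
        \<le> measure_pmf.prob (?ch m) ({y. \<not> ?match m y} \<union> (\<Union>m'\<in>{1..M} - {m}. {y. ?match m' y}))"
      by (intro measure_pmf.finite_measure_mono) auto
    also have "\<dots> \<le> measure_pmf.prob (?ch m) {y. \<not> ?match m y}
        + measure_pmf.prob (?ch m) (\<Union>m'\<in>{1..M} - {m}. {y. ?match m' y})"
      by (rule measure_Un_le) auto
    also have "measure_pmf.prob (?ch m) (\<Union>m'\<in>{1..M} - {m}. {y. ?match m' y})
        \<le> (\<Sum>m'\<in>{1..M} - {m}. measure_pmf.prob (?ch m) {y. ?match m' y})"
      by (rule measure_UNION_le) auto
    finally show ?thesis by simp
  qed
  hence "(\<Sum>m\<in>{1..M}. measure_pmf.prob (?ch m) {y. ?dec y \<noteq> Some m}) / M \<le> (\<Sum>m\<in>{1..M}.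
      measure_pmf.prob (?ch m) {y. \<not> ?match m y}
      + (\<Sum>m'\<in>{1..M} - {m}. measure_pmf.prob (?ch m) {y. ?match m' y})) / M"
    by (intro divide_right_mono sum_mono) auto
  moreover have "error_prob W f p \<epsilon> n M b s = (\<Sum>m\<in>{1..M}. measure_pmf.prob (?ch m) {y. ?dec y \<noteq> Some m}) / M"
  proof -
    have "error_prob W f p \<epsilon> n M b s = measure_pmf.expectation (pmf_of_set {1..M})
        (\<lambda>m. measure_pmf.prob (map_pmf (\<lambda>y. (m, y)) (?ch m)) {(m, y). ?dec y \<noteq> Some m})"
      unfolding error_prob_def measure_bind_pmf map_pmf_def ch_def ..
    also have "\<dots> = (\<Sum>m\<in>{1..M}. measure_pmf.prob (?ch m) {y. ?dec y \<noteq> Some m}) / M"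
      using M by (subst integral_pmf_of_set) (auto simp: vimage_def)
    finally show ?thesis .
  qed
  ultimately show ?thesis by simp
qed

text \<open>The selection lemma yields a set of labelled codewords; numbering it by a bijection
  makes the message map injective and turns its total cost into the bound of
  \<open>error_prob_le\<close>.\<close>

lemma exists_sign_encoder:
  fixes W :: "int \<Rightarrow> 'y pmf" and f :: "('m::finite \<Rightarrow> bool) \<Rightarrow> int" and p :: "('m \<Rightarrow> bool) pmf"
    and \<epsilon> :: real and n :: nat
  defines "P \<equiv> joint_law W f p" and "N \<equiv> card (codewords W f p \<epsilon> n)"
  assumes \<epsilon>: "\<epsilon> > 0" and n: "n > 0" and M: "1 \<le> M" "M \<le> N" and H: "match_entropy P \<le> 1"
  shows "\<exists>b s. sign_encoder W f p \<epsilon> n M b s \<and> error_prob W f p \<epsilon> n M b s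
      \<le> \<epsilon> + (real M - 1) * 2 powr (real n * (2 * (real CARD('m) + 1) * \<epsilon>)) / (real N - 1)"
proof -
  let ?C = "2 powr (real n * (2 * (real CARD('m) + 1) * \<epsilon>))"
  let ?S = "{..<n} \<rightarrow>\<^sub>E signs"
  define ch where "ch = (\<lambda>b s. channel_seq W n (\<lambda>i. amplitude_seq f b i * s i))"
  define F where "F = (\<lambda>b s. measure_pmf.prob (ch b s) {y. \<not> BMD_match P \<epsilon> n b s y})"
  define G where "G = (\<lambda>b s b' s'. measure_pmf.prob (ch b s) {y. BMD_match P \<epsilon> n b' s' y})"
  have "\<exists>T \<sigma>. T \<subseteq> codewords W f p \<epsilon> n \<and> card T = M \<and> \<sigma> \<in> T \<rightarrow> ?S \<and>
    (\<Sum>a\<in>T. F a (\<sigma> a) + (\<Sum>a'\<in>T - {a}. G a (\<sigma> a) a' (\<sigma> a')))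
      \<le> M * (\<epsilon> + (real M - 1) * ?C / (real (card (codewords W f p \<epsilon> n)) - 1))"
  proof (rule exists_good_labelled_subset[OF finite_codewords _ sign_seqs_finite])
    show "M \<le> card (codewords W f p \<epsilon> n)" using M by (simp add: N_def)
    show "(\<Sum>s\<in>?S. F b s) \<le> \<epsilon> * card ?S" if "b \<in> codewords W f p \<epsilon> n" for b
      using sum_no_match_le[of b W f p n \<epsilon>] that by (simp add: codewords_def F_def ch_def P_def)
    show "(\<Sum>b'\<in>codewords W f p \<epsilon> n. \<Sum>s'\<in>?S. G b s b' s') \<le> ?C * card ?S" for b s
      unfolding G_def by (rule sum_prob_match_le[OF n _ finite_codewords H]) (auto simp: codewords_def)
  qed (simp add: G_def)
  then obtain T \<sigma> where T: "T \<subseteq> codewords W f p \<epsilon> n" "card T = M" and \<sigma>: "\<sigma> \<in> T \<rightarrow> ?S"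
    and tot: "(\<Sum>a\<in>T. F a (\<sigma> a) + (\<Sum>a'\<in>T - {a}. G a (\<sigma> a) a' (\<sigma> a')))
      \<le> M * (\<epsilon> + (real M - 1) * ?C / (real N - 1))"
    unfolding N_def by blast
  have finT: "finite T" using T finite_codewords finite_subset by blast
  obtain e where e: "bij_betw e {1..M} T"
    using ex_bij_betw_nat_finite_1[OF finT] T(2) by blast
  have eT: "e m \<in> T" if "m \<in> {1..M}" for m using e that by (auto simp: bij_betw_def)
  have e': "bij_betw e ({1..M} - {m}) (T - {e m})" if "m \<in> {1..M}" for m
    using bij_betw_DiffI[OF e, of "{m}" "{e m}"] that eT[OF that] by simp
  have "error_prob W f p \<epsilon> n M e (\<sigma> \<circ> e)
      \<le> (\<Sum>m\<in>{1..M}. F (e m) (\<sigma> (e m)) + (\<Sum>m'\<in>{1..M} - {m}. G (e m) (\<sigma> (e m)) (e m') (\<sigma> (e m')))) / M"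
    using error_prob_le[OF M(1), of W f p \<epsilon> n e "\<sigma> \<circ> e"] by (simp add: F_def G_def ch_def P_def)
  also have "(\<Sum>m\<in>{1..M}. F (e m) (\<sigma> (e m)) + (\<Sum>m'\<in>{1..M} - {m}. G (e m) (\<sigma> (e m)) (e m') (\<sigma> (e m'))))
      = (\<Sum>m\<in>{1..M}. F (e m) (\<sigma> (e m)) + (\<Sum>a'\<in>T - {e m}. G (e m) (\<sigma> (e m)) a' (\<sigma> a')))"
    by (intro sum.cong refl arg_cong2[of _ _ _ _ "(+)"])
       (rule sum.reindex_bij_betw[OF e', of _ "\<lambda>a'. G (e _) (\<sigma> (e _)) a' (\<sigma> a')"])
  also have "\<dots> = (\<Sum>a\<in>T. F a (\<sigma> a) + (\<Sum>a'\<in>T - {a}. G a (\<sigma> a) a' (\<sigma> a')))"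
    by (rule sum.reindex_bij_betw[OF e, of "\<lambda>a. F a (\<sigma> a) + (\<Sum>a'\<in>T - {a}. G a (\<sigma> a) a' (\<sigma> a'))"])
  also have "\<dots> / M \<le> (M * (\<epsilon> + (real M - 1) * ?C / (real N - 1))) / M"
    by (rule divide_right_mono[OF tot]) simp
  also have "\<dots> = \<epsilon> + (real M - 1) * ?C / (real N - 1)" using M by simp
  finally have err: "error_prob W f p \<epsilon> n M e (\<sigma> \<circ> e) \<le> \<epsilon> + (real M - 1) * ?C / (real N - 1)" .
  have "sign_encoder W f p \<epsilon> n M e (\<sigma> \<circ> e)"
    unfolding sign_encoder_def
  proof (intro conjI ballI)
    show "inj_on e {1..M}" using e by (simp add: bij_betw_def)
    fix m assume m: "m \<in> {1..M}"
    have "e m \<in> codewords W f p \<epsilon> n" using T eT[OF m] by blast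
    thus "\<forall>j. e m j \<in> {..<n} \<rightarrow>\<^sub>E UNIV"
      and "seqs (e m) undefined undefined \<in> B_typical (joint_law W f p) {Sign, Out} Bits n \<epsilon>"
      by (auto simp: codewords_def)
    show "(\<sigma> \<circ> e) m \<in> ?S" using \<sigma> eT[OF m] by auto
  qed (use \<epsilon> M in auto)
  thus ?thesis using err by blast
qed

theorem achievable_entropy:
  fixes W :: "int \<Rightarrow> 'y pmf" and f :: "('m::finite \<Rightarrow> bool) \<Rightarrow> int" and p :: "('m \<Rightarrow> bool) pmf"
  defines "P \<equiv> joint_law W f p"
  assumes fin: "\<And>J. has_finite_entropy P J" and H: "match_entropy P \<le> 1"
  shows "achievable W f (ent P Bits)"
  unfolding achievable_def
proof (intro allI impI)
  fix \<delta> :: real assume \<delta>: "\<delta> > 0"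
  define c where "c = 2 * (real CARD('m) + 1)"
  have c: "c \<ge> 2" by (simp add: c_def)
  \<comment> \<open>The error exponent will be \<open>(c + 1) * \<epsilon> - \<delta>\<close>, which
    this choice keeps below \<open>- \<delta> / 2\<close>; the other bound ensures
    \<open>\<epsilon> < 1\<close> for counting codewords.\<close>
  define \<epsilon> where "\<epsilon> = min (1 / 2) (\<delta> / (2 * (c + 1)))"
  have \<epsilon>: "0 < \<epsilon>" "\<epsilon> < 1" using \<delta> c by (auto simp: \<epsilon>_def)
  have c\<epsilon>: "(c + 1) * \<epsilon> \<le> \<delta> / 2"
  proof -
    have "(c + 1) * \<epsilon> \<le> (c + 1) * (\<delta> / (2 * (c + 1)))" using c by (intro mult_left_mono) (auto simp: \<epsilon>_def)
    also have "\<dots> = \<delta> / 2" using c by (simp add: field_simps)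
    finally show ?thesis .
  qed
  have "3 * \<epsilon> \<le> (c + 1) * \<epsilon>" using c \<epsilon> by (intro mult_right_mono) auto
  \<comment> \<open>Used twice: the mismatch term \<open>\<epsilon>\<close> stays strictly below
    \<open>\<delta>\<close>, and \<open>\<delta> - \<epsilon>\<close> is at least
    \<open>\<delta> / 2\<close>.\<close>
  hence \<epsilon>\<delta>: "3 * \<epsilon> \<le> \<delta> / 2" using c\<epsilon> by linarith
  define h where "h = ent P Bits"
  have aep: "\<forall>\<^sub>F n in sequentially. measure_pmf.prob (Pi_pmf {..<n} undefined (\<lambda>_. P))
      {v. (\<lambda>k i. v i k) \<notin> typical P (Bits \<union> {Sign, Out}) n \<epsilon>} < \<epsilon> / 2"
    using \<epsilon> by (intro order_tendstoD(2)[OF asymptotic_equipartition[OF fin]]) auto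
  have small: "\<forall>\<^sub>F n in sequentially. \<epsilon> + 4 * 2 powr (- (real n * (\<delta> / 2))) < \<delta>"
  proof -
    have "(\<lambda>n. \<epsilon> + 4 * 2 powr (- (real n * (\<delta> / 2)))) \<longlonglongrightarrow> \<epsilon>" using \<delta> by real_asymp
    thus ?thesis by (rule order_tendstoD(2)) (use \<epsilon>\<delta> \<delta> in linarith)
  qed
  have large: "\<forall>\<^sub>F n in sequentially. real n * (\<delta> / 2) \<ge> 1" using \<delta> by real_asymp
  show "\<forall>\<^sub>F n in sequentially. \<exists>p \<epsilon> M\<^sub>a M\<^sub>s b s. M\<^sub>s = 1 \<and> sign_encoder W f p \<epsilon> n M\<^sub>a b s \<and>
      ent P Bits - \<delta> \<le> 1 / real n * log 2 (real (M\<^sub>a * M\<^sub>s)) \<and> error_prob W f p \<epsilon> n M\<^sub>a b s \<le> \<delta>"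
    using aep small large eventually_gt_at_top[of 0]
  proof eventually_elim
    case (elim n)
    define N where "N = card (codewords W f p \<epsilon> n)"
    have N: "real N \<ge> 2 powr (real n * (h - \<epsilon>)) / 2"
      unfolding N_def h_def P_def
      using elim \<epsilon> by (intro card_codewords_ge) (auto simp: P_def)
    \<comment> \<open>Rounding up secures the rate and costs nothing: the error bound involves
      \<open>M - 1\<close>, and \<open>M \<le> N\<close> survives as \<open>N\<close> is an
      integer.\<close>
    define M where "M = nat \<lceil>2 powr (real n * (h - \<delta>))\<rceil>"
    have M1: "M \<ge> 1" by (simp add: M_def Suc_le_eq)
    have Mge: "real M \<ge> 2 powr (real n * (h - \<delta>))" unfolding M_def by linarith
    have Mle: "real M - 1 \<le> 2 powr (real n * (h - \<delta>))"
      unfolding M_def by (simp add: of_nat_nat)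
    \<comment> \<open>The \<open>- 1\<close> in the exponent pays for the factor one half in the
      number of codewords.\<close>
    have "2 powr (real n * (h - \<delta>)) \<le> 2 powr (real n * (h - \<epsilon>) - 1)"
    proof (intro powr_mono)
      have "real n * (\<delta> / 2) \<le> real n * (\<delta> - \<epsilon>)" using \<epsilon>\<delta> \<epsilon> by (intro mult_left_mono) auto
      thus "real n * (h - \<delta>) \<le> real n * (h - \<epsilon>) - 1" using elim by (simp add: algebra_simps)
    qed simp
    also have "\<dots> = 2 powr (real n * (h - \<epsilon>)) / 2" by (simp add: powr_diff)
    also have "\<dots> \<le> real N" by (rule N)
    finally have "M \<le> N" unfolding M_def by (simp add: nat_le_iff ceiling_le_iff)
    then obtain b s where bs: "sign_encoder W f p \<epsilon> n M b s"
      "error_prob W f p \<epsilon> n M b s \<le> \<epsilon> + (real M - 1) * 2 powr (real n * (c * \<epsilon>)) / (real N - 1)"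
      using exists_sign_encoder[of \<epsilon> n M W f p] \<epsilon> elim M1 H unfolding N_def P_def c_def by blast
    \<comment> \<open>A single message has no competitor, and then \<open>N - 1\<close> could be 0.
      Otherwise \<open>N - 1\<close> is at least half of \<open>N\<close>, which together with the
      half in \<open>N\<close> gives the factor 4.\<close>
    have "(real M - 1) * 2 powr (real n * (c * \<epsilon>)) / (real N - 1) \<le> 4 * 2 powr (- (real n * (\<delta> / 2)))"
    proof (cases "M = 1")
      case False
      hence "N \<ge> 2" using M1 \<open>M \<le> N\<close> by linarith
      hence N4: "2 powr (real n * (h - \<epsilon>)) / 4 \<le> real N - 1" using N by linarith
      have "(real M - 1) * 2 powr (real n * (c * \<epsilon>)) / (real N - 1)
          \<le> 2 powr (real n * (h - \<delta>)) * 2 powr (real n * (c * \<epsilon>)) / (2 powr (real n * (h - \<epsilon>)) / 4)"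
        using M1 Mle N4 by (intro frac_le mult_right_mono) auto
      also have "\<dots> = 4 * 2 powr (real n * (h - \<delta>) + real n * (c * \<epsilon>) - real n * (h - \<epsilon>))"
        by (simp add: powr_diff powr_add)
      also have "real n * (h - \<delta>) + real n * (c * \<epsilon>) - real n * (h - \<epsilon>) = real n * ((c + 1) * \<epsilon> - \<delta>)"
        by (simp add: algebra_simps)
      also have "4 * 2 powr (real n * ((c + 1) * \<epsilon> - \<delta>)) \<le> 4 * 2 powr (real n * (- (\<delta> / 2)))"
        using c\<epsilon> by (intro mult_left_mono powr_mono) auto
      finally show ?thesis by simp
    qed simp
    hence err: "error_prob W f p \<epsilon> n M b s \<le> \<delta>" using bs(2) elim by linarith
    have "h - \<delta> = 1 / real n * log 2 (2 powr (real n * (h - \<delta>)))" using elim by simp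
    also have "\<dots> \<le> 1 / real n * log 2 (real M)"
      using Mge M1 by (intro mult_left_mono log_mono) auto
    finally have "ent P Bits - \<delta> \<le> 1 / real n * log 2 (real (M * 1))" by (simp add: h_def)
    thus ?case using bs(1) err by blast
  qed
qed


section \<open>Existence of a maximising distribution\<close>

text \<open>A term of \<open>H(u|Y)\<close>, the logarithm being that of \<open>1 / p(u|y)\<close>.
  Keeping this as one quotient makes each term nonnegative, which the separate joint entropies would
  not allow.\<close>

definition cond_ent_summand :: "('m rv \<Rightarrow> 'y val) pmf \<Rightarrow> 'm rv \<Rightarrow> ('m rv \<Rightarrow> 'y val) \<Rightarrow> real" where
  "cond_ent_summand P u z = pmf (marginal P {u, Out}) z *
     log 2 (pmf (marginal P {Out}) (sub {Out} z) / pmf (marginal P {u, Out}) z)"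

lemma cond_ent_summand_nonneg: "cond_ent_summand P u z \<ge> 0"
proof (cases "pmf (marginal P {u, Out}) z = 0")
  case False
  hence pos: "pmf (marginal P {u, Out}) z > 0" by (simp add: order_less_le)
  moreover have "pmf (marginal P {u, Out}) z \<le> pmf (marginal P {Out}) (sub {Out} z)"
    by (rule pmf_marginal_mono) simp
  ultimately show ?thesis by (simp add: cond_ent_summand_def)
qed (simp add: cond_ent_summand_def)

lemma cond_ent_summand_integral:
  assumes fin: "\<And>J. has_finite_entropy P J"
  shows "integrable (count_space UNIV) (cond_ent_summand P u)"
    and "ent P {u, Out} - ent P {Out} = (\<integral>z. cond_ent_summand P u z \<partial>count_space UNIV)"
proof -
  let ?Q = "marginal P {u, Out}" and ?R = "marginal P {Out}"
  let ?g = "\<lambda>z. log 2 (pmf ?R (sub {Out} z) / pmf ?Q z)"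
  have sub: "sub {Out} (sub {u, Out} x) = sub {Out} x" for x :: "'a rv \<Rightarrow> 'b val"
    by (auto simp: restrict_def fun_eq_iff)
  have AE: "AE x in measure_pmf P. ?g (sub {u, Out} x) = log_pmf_marginal P {Out} x - log_pmf_marginal P {u, Out} x"
    unfolding AE_measure_pmf_iff sub
    by (auto simp: log_divide pmf_marginal_pos[THEN less_imp_neq, symmetric])
  have int: "integrable (measure_pmf P) (\<lambda>x. log_pmf_marginal P {Out} x - log_pmf_marginal P {u, Out} x)"
    by (intro Bochner_Integration.integrable_diff has_finite_entropy_integrable fin)
  have "integrable (measure_pmf P) (\<lambda>x. ?g (sub {u, Out} x))"
    using int by (subst integrable_cong_AE[OF _ _ AE]) auto
  hence "integrable ?Q ?g" by (simp add: marginal_def integrable_distr_eq map_pmf_rep_eq)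
  thus "integrable (count_space UNIV) (cond_ent_summand P u)"
    unfolding measure_pmf_eq_density cond_ent_summand_def[abs_def] by (subst (asm) integrable_real_density) auto
  have "ent P {u, Out} - ent P {Out}
      = measure_pmf.expectation P (\<lambda>x. log_pmf_marginal P {Out} x - log_pmf_marginal P {u, Out} x)"
    using fin by (simp add: ent_eq_expectation has_finite_entropy_integrable)
  also have "\<dots> = measure_pmf.expectation P (\<lambda>x. ?g (sub {u, Out} x))"
    using AE by (intro integral_cong_AE) auto
  also have "\<dots> = measure_pmf.expectation ?Q ?g" by (simp add: marginal_def)
  also have "\<dots> = (\<integral>z. cond_ent_summand P u z \<partial>count_space UNIV)"
    unfolding measure_pmf_eq_density cond_ent_summand_def[abs_def] by (subst integral_density) auto
  finally show "ent P {u, Out} - ent P {Out} = (\<integral>z. cond_ent_summand P u z \<partial>count_space UNIV)" .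
qed

text \<open>An integral of nonnegative terms is the supremum of its finite partial sums; an upper
  bound on an infinite series thus becomes a family of conditions on finite sums.\<close>

lemma integral_count_space_le_iff:
  fixes h :: "'a \<Rightarrow> real"
  assumes int: "integrable (count_space UNIV) h" and nn: "\<And>z. h z \<ge> 0"
  shows "(\<integral>z. h z \<partial>count_space UNIV) \<le> c \<longleftrightarrow> (\<forall>F. finite F \<longrightarrow> sum h F \<le> c)"
proof -
  have abs: "Infinite_Set_Sum.abs_summable_on h UNIV" using int by (simp add: abs_summable_on_def)
  hence summ: "h summable_on UNIV"
    using abs_summable_equivalent abs_summable_summable by blast
  have eq: "(\<integral>z. h z \<partial>count_space UNIV) = infsum h UNIV"
    using infsetsum_infsum[OF abs] by (simp add: infsetsum_def)
  show ?thesis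
    unfolding eq using infsum_le_finite_sums[OF summ, of c] finite_sum_le_infsum[OF summ] nn
    by (meson order_trans subset_UNIV)
qed

lemma match_entropy_le_iff:
  fixes P :: "('m::finite rv \<Rightarrow> 'y val) pmf"
  assumes fin: "\<And>J. has_finite_entropy P J"
  shows "match_entropy P \<le> c \<longleftrightarrow>
    (\<forall>F. finite F \<longrightarrow> (\<Sum>z\<in>F. cond_ent_summand P Sign z + (\<Sum>j\<in>UNIV. cond_ent_summand P (Bit j) z)) \<le> c)"
proof -
  let ?h = "\<lambda>z. cond_ent_summand P Sign z + (\<Sum>j\<in>UNIV. cond_ent_summand P (Bit j) z)"
  note int = cond_ent_summand_integral(1)[OF fin]
  have "match_entropy P = (\<integral>z. ?h z \<partial>count_space UNIV)"
    unfolding match_entropy_def cond_ent_summand_integral(2)[OF fin]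
    by (subst Bochner_Integration.integral_add, rule int, rule Bochner_Integration.integrable_sum, rule int)
       (subst Bochner_Integration.integral_sum, auto intro: int)
  moreover have "integrable (count_space UNIV) ?h"
    by (intro Bochner_Integration.integrable_add Bochner_Integration.integrable_sum int)
  ultimately show ?thesis
    using integral_count_space_le_iff[of ?h c] by (simp add: cond_ent_summand_nonneg sum_nonneg)
qed

section \<open>Entropies of the bits and the sign\<close>

lemma expectation_marginal_joint_law_Bits:
  fixes p :: "('m::finite \<Rightarrow> bool) pmf" and g :: "('m rv \<Rightarrow> 'y val) \<Rightarrow> real"
  shows "measure_pmf.expectation (joint_law W f p) (\<lambda>x. g (sub Bits x)) = (\<Sum>b\<in>UNIV. pmf p b * g (bits_val b))"
proof -
  have "measure_pmf.expectation (joint_law W f p) (\<lambda>x. g (sub Bits x))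
      = measure_pmf.expectation (marginal (joint_law W f p) Bits) g"
    by (simp add: marginal_def)
  also have "\<dots> = measure_pmf.expectation p (\<lambda>b. g (bits_val b))"
    by (simp add: marginal_joint_law_Bits)
  also have "\<dots> = (\<Sum>b\<in>UNIV. pmf p b * g (bits_val b))"
    by (subst integral_measure_pmf[of UNIV]) auto
  finally show ?thesis .
qed

lemma ent_Bits:
  fixes p :: "('m::finite \<Rightarrow> bool) pmf" and W :: "int \<Rightarrow> 'y pmf"
  assumes "has_finite_entropy (joint_law W f p) Bits"
  shows "ent (joint_law W f p) Bits = - (\<Sum>b\<in>UNIV. pmf p b * log 2 (pmf p b))"
  unfolding ent_eq_expectation[OF assms]
    expectation_marginal_joint_law_Bits[where g = "\<lambda>z. log 2 (pmf (marginal (joint_law W f p) Bits) z)"]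
    pmf_marginal_joint_law_Bits ..

lemma pmf_marginal_joint_law_Sign_Bits:
  fixes p :: "('m::finite \<Rightarrow> bool) pmf" and W :: "int \<Rightarrow> 'y pmf"
  assumes s: "s \<in> signs"
  shows "pmf (marginal (joint_law W f p) (insert Sign Bits)) (sub (insert Sign Bits) (letter b s y)) = pmf p b / 2"
proof -
  let ?J = "insert Sign Bits :: 'm rv set"
  define e :: "('m \<Rightarrow> bool) \<times> int \<Rightarrow> 'm rv \<Rightarrow> 'y val" where
    "e = (\<lambda>(b, s). sub ?J (letter b s undefined))"
  have e: "sub ?J (letter b s y) = e (b, s)" for b s y
    by (auto simp: e_def restrict_def fun_eq_iff)
  have "inj e"
  proof (rule injI, clarify)
    fix b s b' s' assume eq: "e (b, s) = e (b', s')"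
    have "b j = b' j" for j using fun_cong[OF eq, of "Bit j"] by (simp add: e_def)
    moreover have "s = s'" using fun_cong[OF eq, of Sign] by (simp add: e_def)
    ultimately show "b = b' \<and> s = s'" by auto
  qed
  have "marginal (joint_law W f p) ?J = map_pmf e (pair_pmf p (pmf_of_set signs))"
    by (simp add: marginal_def joint_law_def map_bind_pmf e pair_pmf_def)
  hence "pmf (marginal (joint_law W f p) ?J) (e (b, s)) = pmf (pair_pmf p (pmf_of_set signs)) (b, s)"
    using pmf_map_inj'[OF \<open>inj e\<close>] by simp
  thus ?thesis using s by (simp add: e pmf_pair signs_facts)
qed

text \<open>An independent uniform sign halves every probability, which lowers its binary logarithm
  by 1.\<close>

lemma ent_Sign_Bits:
  fixes p :: "('m::finite \<Rightarrow> bool) pmf" and W :: "int \<Rightarrow> 'y pmf"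
  assumes fin: "\<And>J. has_finite_entropy (joint_law W f p) J"
  shows "ent (joint_law W f p) (insert Sign Bits) = 1 + ent (joint_law W f p) Bits"
proof -
  let ?P = "joint_law W f p"
  have "measure_pmf.expectation ?P (log_pmf_marginal ?P (insert Sign Bits))
      = measure_pmf.expectation ?P (\<lambda>x. log_pmf_marginal ?P Bits x - 1)"
  proof (rule integral_cong_AE)
    show "AE x in measure_pmf ?P. log_pmf_marginal ?P (insert Sign Bits) x = log_pmf_marginal ?P Bits x - 1"
      unfolding AE_measure_pmf_iff
    proof
      fix x assume "x \<in> set_pmf ?P"
      then obtain b where b: "b \<in> set_pmf p" "x \<in> set_pmf (letter_law W f b)" by (auto simp: joint_law_eq)
      then obtain s y where x: "s \<in> signs" "x = letter b s y" using set_letter_lawD by blast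
      have "pmf p b > 0" using b by (simp add: pmf_positive)
      thus "log_pmf_marginal ?P (insert Sign Bits) x = log_pmf_marginal ?P Bits x - 1"
        unfolding x(2) pmf_marginal_joint_law_Sign_Bits[OF x(1)] sub_Bits_letter pmf_marginal_joint_law_Bits
        by (simp add: log_divide)
    qed
  qed simp_all
  also have "\<dots> = measure_pmf.expectation ?P (log_pmf_marginal ?P Bits) - 1"
    by (subst Bochner_Integration.integral_diff) (auto intro: has_finite_entropy_integrable fin)
  finally show ?thesis by (simp add: ent_eq_expectation[OF fin])
qed

lemma R_BMD_eq:
  fixes p :: "('m::finite \<Rightarrow> bool) pmf" and W :: "int \<Rightarrow> 'y::countable pmf"
  assumes fin: "\<And>J. has_finite_entropy (joint_law W f p) J"
  shows "R_BMD W f p = 1 + ent (joint_law W f p) Bits - match_entropy (joint_law W f p)"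
proof -
  have cnt: "countable (UNIV :: ('m rv \<Rightarrow> 'y val) set)" by (rule countableI_type)
  show ?thesis
    unfolding R_BMD_def Let_def cond_ent_eq[OF fin fin cnt] ent_Sign_Bits[OF fin] match_entropy_def
    by (simp add: insert_commute)
qed

section \<open>Continuity of the entropy terms\<close>

lemma tendsto_mult_log_0: "((\<lambda>x::real. x * log 2 x) \<longlongrightarrow> 0) (at_right 0)"
  by real_asymp

lemma continuous_on_mult_log: "continuous_on {0..} (\<lambda>x::real. x * log 2 x)"
proof (rule continuous_on_eq_continuous_within[THEN iffD2, rule_format])
  fix x :: real assume "x \<in> {0..}"
  show "continuous (at x within {0..}) (\<lambda>x. x * log 2 x)"
  proof (cases "x = 0")
    case True
    have "((\<lambda>x::real. x * log 2 x) \<longlongrightarrow> 0) (at 0 within {0..})"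
      using tendsto_mult_log_0 by (simp add: at_within_Ici_at_right)
    thus ?thesis using True by (simp add: continuous_within)
  next
    case False
    hence "x > 0" using \<open>x \<in> {0..}\<close> by simp
    hence "isCont (\<lambda>x. x * log 2 x) x" by (intro continuous_intros) auto
    thus ?thesis by (rule continuous_at_imp_continuous_at_within)
  qed
qed

text \<open>The upper bound comes from \<open>ln x \<le> x - 1\<close>. It is linear in
  \<open>w\<close>, so it squeezes the function to 0 at the origin.\<close>

lemma mult_log_divide_bounds:
  fixes t w :: real
  assumes "0 \<le> t" "t \<le> w"
  shows "0 \<le> t * log 2 (w / t)" and "t * log 2 (w / t) \<le> w / ln 2"
proof -
  show "0 \<le> t * log 2 (w / t)" using assms by (cases "t = 0") auto
  show "t * log 2 (w / t) \<le> w / ln 2"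
  proof (cases "t = 0")
    case False
    hence t: "t > 0" using assms by simp
    have "ln (w / t) \<le> w / t - 1" using t assms by (intro ln_le_minus_one) auto
    hence "t * ln (w / t) \<le> t * (w / t - 1)" using t by (intro mult_left_mono) auto
    also have "\<dots> \<le> w" using t by (simp add: field_simps)
    finally show ?thesis by (simp add: log_def divide_right_mono)
  qed (use assms in auto)
qed

text \<open>On this wedge, where a joint and a marginal probability always lie, the only singular
  point is the origin. Elsewhere \<open>w > 0\<close>, and the function equals
  \<open>t * log 2 w - t * log 2 t\<close>, also at \<open>t = 0\<close>.\<close>

lemma continuous_on_mult_log_divide:
  "continuous_on {(t, w). 0 \<le> t \<and> t \<le> w} (\<lambda>(t, w). t * log 2 (w / t :: real))"
  (is "continuous_on ?S ?\<Phi>")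
proof (rule continuous_on_eq_continuous_within[THEN iffD2, rule_format])
  fix x assume x: "x \<in> ?S"
  let ?U = "{x :: real \<times> real. snd x > 0}"
  show "continuous (at x within ?S) ?\<Phi>"
  proof (cases "snd x = 0")
    case True
    hence x0: "x = (0, 0)" using x by auto
    have "(?\<Phi> \<longlongrightarrow> 0) (at x within ?S)"
    proof (rule Lim_null_comparison)
      show "\<forall>\<^sub>F y in at x within ?S. norm (?\<Phi> y) \<le> snd y / ln 2"
        unfolding eventually_at_filter
        by (rule always_eventually) (auto simp: mult_log_divide_bounds)
      have "((\<lambda>y. snd y / ln 2) \<longlongrightarrow> snd x / ln 2) (at x within ?S)" by (intro tendsto_intros) auto
      thus "((\<lambda>y. snd y / ln 2) \<longlongrightarrow> 0) (at x within ?S)" using True by simp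
    qed
    thus ?thesis by (simp add: continuous_within x0)
  next
    case False
    hence xU: "x \<in> ?S \<inter> ?U" using x by auto
    have "continuous_on (?S \<inter> ?U) (\<lambda>x. fst x * log 2 (snd x) - fst x * log 2 (fst x))"
      by (intro continuous_intros continuous_on_compose2[OF continuous_on_mult_log]) auto
    hence "continuous_on (?S \<inter> ?U) ?\<Phi>"
    proof (rule continuous_on_eq)
      fix y assume "y \<in> ?S \<inter> ?U"
      thus "fst y * log 2 (snd y) - fst y * log 2 (fst y) = ?\<Phi> y"
        by (cases "fst y = 0") (auto simp: case_prod_unfold log_divide right_diff_distrib)
    qed
    hence "continuous (at x within (?S \<inter> ?U)) ?\<Phi>" using xU by (simp add: continuous_on_eq_continuous_within)
    moreover have "at x within (?S \<inter> ?U) = at x within ?S"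
    proof (rule at_within_nhd)
      show "open ?U" by (intro open_Collect_less continuous_intros)
    qed (use xU in auto)
    ultimately show ?thesis by simp
  qed
qed

text \<open>Distributions become points of a Euclidean space, where compactness and closedness can
  be stated.\<close>

definition prob_simplex :: "(real ^ 'b::finite) set" where
  "prob_simplex = {v. (\<forall>b. 0 \<le> v $ b) \<and> (\<Sum>b\<in>UNIV. v $ b) = 1}"

definition pmf_of_vec :: "real ^ 'b::finite \<Rightarrow> 'b pmf" where
  "pmf_of_vec v = embed_pmf (\<lambda>b. v $ b)"

lemma pmf_pmf_of_vec:
  assumes "v \<in> prob_simplex"
  shows "pmf (pmf_of_vec v) b = v $ b"
  unfolding pmf_of_vec_def
proof (rule pmf_embed_pmf)
  have "(\<Sum>b\<in>UNIV. ennreal (v $ b)) = ennreal (\<Sum>b\<in>UNIV. v $ b)"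
    using assms by (intro sum_ennreal) (auto simp: prob_simplex_def)
  thus "(\<integral>\<^sup>+b. ennreal (v $ b) \<partial>count_space UNIV) = 1"
    using assms by (simp add: nn_integral_count_space_finite prob_simplex_def)
qed (use assms in \<open>auto simp: prob_simplex_def\<close>)

lemma vec_of_pmf:
  fixes p :: "'b::finite pmf"
  shows "(\<chi> b. pmf p b) \<in> prob_simplex" and "pmf_of_vec (\<chi> b. pmf p b) = p"
proof -
  show *: "(\<chi> b. pmf p b) \<in> prob_simplex"
    by (simp add: prob_simplex_def sum_pmf_eq_1)
  show "pmf_of_vec (\<chi> b. pmf p b) = p"
    by (rule pmf_eqI) (simp add: pmf_pmf_of_vec[OF *])
qed

lemma compact_prob_simplex: "compact (prob_simplex :: (real ^ 'b::finite) set)"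
proof (rule compact_eq_bounded_closed[THEN iffD2], intro conjI)
  show "bounded (prob_simplex :: (real ^ 'b) set)"
    unfolding bounded_iff
  proof (intro exI[of _ 1] ballI)
    fix v :: "real ^ 'b" assume "v \<in> prob_simplex"
    thus "norm v \<le> 1" using norm_le_l1_cart[of v] by (simp add: prob_simplex_def)
  qed
  have "prob_simplex = (\<Inter>b. {v :: real ^ 'b. 0 \<le> v $ b}) \<inter> {v. (\<Sum>b\<in>UNIV. v $ b) = 1}"
    by (auto simp: prob_simplex_def)
  also have "closed \<dots>"
    by (intro closed_Int closed_INT ballI closed_Collect_le closed_Collect_eq continuous_intros)
  finally show "closed (prob_simplex :: (real ^ 'b) set)" .
qed

lemma pmf_marginal_joint_law:
  fixes p :: "('m::finite \<Rightarrow> bool) pmf"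
  shows "pmf (marginal (joint_law W f p) J) z = (\<Sum>b\<in>UNIV. pmf p b * pmf (map_pmf (sub J) (letter_law W f b)) z)"
  by (simp add: marginal_def joint_law_eq map_bind_pmf pmf_bind integral_measure_pmf[of UNIV])

lemma continuous_on_pmf_marginal:
  fixes W :: "int \<Rightarrow> 'y pmf" and f :: "('m::finite \<Rightarrow> bool) \<Rightarrow> int"
  shows "continuous_on prob_simplex (\<lambda>v. pmf (marginal (joint_law W f (pmf_of_vec v)) J) z)"
proof (rule continuous_on_eq)
  show "continuous_on prob_simplex (\<lambda>v. \<Sum>b\<in>UNIV. v $ b * pmf (map_pmf (sub J) (letter_law W f b)) z)"
    by (intro continuous_intros)
qed (simp add: pmf_marginal_joint_law pmf_pmf_of_vec)

lemma continuous_on_cond_ent_summand: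
  fixes W :: "int \<Rightarrow> 'y pmf" and f :: "('m::finite \<Rightarrow> bool) \<Rightarrow> int"
  shows "continuous_on prob_simplex (\<lambda>v. cond_ent_summand (joint_law W f (pmf_of_vec v)) u z)"
proof -
  let ?P = "\<lambda>v. joint_law W f (pmf_of_vec v)"
  have "continuous_on prob_simplex (\<lambda>v. (\<lambda>(t, w). t * log 2 (w / t))
      (pmf (marginal (?P v) {u, Out}) z, pmf (marginal (?P v) {Out}) (sub {Out} z)))"
    by (rule continuous_on_compose2[OF continuous_on_mult_log_divide])
       (auto intro!: continuous_on_Pair continuous_on_pmf_marginal pmf_marginal_mono)
  thus ?thesis by (simp add: cond_ent_summand_def)
qed

lemma closed_match_entropy_le:
  fixes W :: "int \<Rightarrow> 'y pmf" and f :: "('m::finite \<Rightarrow> bool) \<Rightarrow> int"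
  assumes fin: "\<And>p J. has_finite_entropy (joint_law W f p) J"
  shows "closed {v \<in> prob_simplex. match_entropy (joint_law W f (pmf_of_vec v)) \<le> c}"
proof -
  let ?h = "\<lambda>v z. cond_ent_summand (joint_law W f (pmf_of_vec v)) Sign z
      + (\<Sum>j\<in>UNIV. cond_ent_summand (joint_law W f (pmf_of_vec v)) (Bit j) z)"
  have "{v \<in> prob_simplex. match_entropy (joint_law W f (pmf_of_vec v)) \<le> c}
      = (\<Inter>F\<in>{F. finite F}. {v \<in> prob_simplex. (\<Sum>z\<in>F. ?h v z) \<le> c})"
    unfolding match_entropy_le_iff[OF fin] by blast
  also have "closed \<dots>"
    by (intro closed_INT ballI continuous_on_closed_Collect_le continuous_intros continuous_on_cond_ent_summand
        compact_imp_closed compact_prob_simplex)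
  finally show ?thesis .
qed

text \<open>The relative entropy of \<open>P\<close> with respect to the law with a uniform sign independent of the
  output is nonnegative.\<close>
lemma ent_Sign_given_Out_le_1:
  fixes P :: "('m rv \<Rightarrow> 'y val) pmf"
  assumes fin: "\<And>J. has_finite_entropy P J"
    and sign: "\<And>x. x \<in> set_pmf P \<Longrightarrow> \<exists>s\<in>signs. x Sign = SignVal s"
  shows "ent P {Sign, Out} - ent P {Out} \<le> 1"
proof -
  let ?Q = "marginal P {Sign, Out}" and ?R = "marginal P {Out}"
  let ?r = "\<lambda>z. pmf ?R (sub {Out} z) / pmf ?Q z"
  \<comment> \<open>Puts a sign back into an output letter. Summed over both signs, the images of
    the output law have total mass 2 and dominate \<open>?Q\<close> times \<open>?r\<close>.\<close>
  define ext where "ext s k = (\<lambda>i. if i = Sign then SignVal s else k i)" for s and k :: "'m rv \<Rightarrow> 'y val"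
  have sub: "sub {Out} (sub {Sign, Out} x) = sub {Out} x" for x :: "'m rv \<Rightarrow> 'y val"
    by (auto simp: restrict_def fun_eq_iff)
  have le: "pmf ?Q z * ?r z \<le> (\<Sum>s\<in>signs. pmf (map_pmf (ext s) ?R) z)" for z
  proof (cases "pmf ?Q z = 0")
    case False
    then obtain x where x: "x \<in> set_pmf P" "z = sub {Sign, Out} x"
      by (auto simp: marginal_def simp flip: set_pmf_iff)
    obtain s where s: "s \<in> signs" "x Sign = SignVal s" using sign x by blast
    have z: "ext s (sub {Out} z) = z"
      using s by (auto simp: x(2) ext_def restrict_def fun_eq_iff)
    have "pmf ?Q z * ?r z = pmf ?R (sub {Out} z)" using False by simp
    also have "\<dots> \<le> pmf (map_pmf (ext s) ?R) z"
      unfolding pmf_map using z by (simp add: measure_pmf_single[symmetric] measure_pmf.finite_measure_mono)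
    also have "\<dots> \<le> (\<Sum>s\<in>signs. pmf (map_pmf (ext s) ?R) z)"
      using s signs_facts by (intro member_le_sum) auto
    finally show ?thesis .
  qed (simp add: sum_nonneg)
  have "(\<integral>\<^sup>+z. ennreal (?r z) \<partial>?Q) = (\<integral>\<^sup>+z. ennreal (pmf ?Q z * ?r z) \<partial>count_space UNIV)"
    unfolding nn_integral_measure_pmf by (intro nn_integral_cong ennreal_mult[symmetric]) auto
  also have "\<dots> \<le> (\<integral>\<^sup>+z. (\<Sum>s\<in>signs. ennreal (pmf (map_pmf (ext s) ?R) z)) \<partial>count_space UNIV)"
    using le by (intro nn_integral_mono) (simp add: sum_ennreal ennreal_leI)
  also have "\<dots> = (\<Sum>s\<in>signs. \<integral>\<^sup>+z. pmf (map_pmf (ext s) ?R) z \<partial>count_space UNIV)"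
    by (rule nn_integral_sum) simp
  also have "\<dots> = 2"
    unfolding nn_integral_pmf by (simp add: signs_facts measure_pmf.emeasure_space_1[simplified])
  finally have nn: "(\<integral>\<^sup>+z. ennreal (?r z) \<partial>?Q) \<le> ennreal 2" by simp
  have intr: "integrable ?Q ?r"
    using nn by (intro integrableI_nonneg) (auto simp: less_top[symmetric] top_unique)
  have Er: "measure_pmf.expectation ?Q ?r \<le> 2"
  proof -
    have "(\<integral>\<^sup>+z. ennreal (?r z) \<partial>?Q) = ennreal (measure_pmf.expectation ?Q ?r)"
      by (rule nn_integral_eq_integral[OF intr]) simp
    with nn have "ennreal (measure_pmf.expectation ?Q ?r) \<le> ennreal 2" by (simp only:)
    thus ?thesis by (subst (asm) ennreal_le_iff) auto
  qed
  have intr': "integrable (measure_pmf P) (\<lambda>x. ?r (sub {Sign, Out} x))"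
    using intr by (simp add: marginal_def integrable_distr_eq map_pmf_rep_eq)
  have "ent P {Sign, Out} - ent P {Out} - 1
      = measure_pmf.expectation P (\<lambda>x. log_pmf_marginal P {Out} x - log_pmf_marginal P {Sign, Out} x - 1)"
    using fin by (simp add: ent_eq_expectation has_finite_entropy_integrable)
  \<comment> \<open>This is \<open>ln x \<le> x - 1\<close> at half the ratio \<open>?r\<close>; the
    half stems from subtracting 1 bit.\<close>
  also have "\<dots> \<le> measure_pmf.expectation P (\<lambda>x. (?r (sub {Sign, Out} x) / 2 - 1) / ln 2)"
  proof (rule integral_mono_AE)
    show "AE x in measure_pmf P. log_pmf_marginal P {Out} x - log_pmf_marginal P {Sign, Out} x - 1
        \<le> (?r (sub {Sign, Out} x) / 2 - 1) / ln 2"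
      unfolding AE_measure_pmf_iff sub
    proof
      fix x assume x: "x \<in> set_pmf P"
      define t where "t = pmf ?Q (sub {Sign, Out} x)"
      define w where "w = pmf ?R (sub {Out} x)"
      have pos: "t > 0" "w > 0" using pmf_marginal_pos[OF x] by (auto simp: t_def w_def)
      have "log 2 w - log 2 t - 1 = ln (w / t / 2) / ln 2"
        using pos by (simp add: log_def ln_div ln_mult diff_divide_distrib add_divide_distrib)
      also have "\<dots> \<le> (w / t / 2 - 1) / ln 2"
        using pos by (intro divide_right_mono ln_le_minus_one) auto
      finally show "log_pmf_marginal P {Out} x - log_pmf_marginal P {Sign, Out} x - 1
        \<le> (pmf ?R (sub {Out} x) / pmf ?Q (sub {Sign, Out} x) / 2 - 1) / ln 2"
        by (simp add: t_def w_def)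
    qed
    show "integrable (measure_pmf P) (\<lambda>x. log_pmf_marginal P {Out} x - log_pmf_marginal P {Sign, Out} x - 1)"
      by (intro Bochner_Integration.integrable_diff has_finite_entropy_integrable fin) simp
    show "integrable (measure_pmf P) (\<lambda>x. (?r (sub {Sign, Out} x) / 2 - 1) / ln 2)"
      using intr' by (intro integrable_divide Bochner_Integration.integrable_diff) (simp_all only: sub integrable_const measure_pmf.integrable_const)
  qed
  also have "\<dots> = (measure_pmf.expectation P (\<lambda>x. ?r (sub {Sign, Out} x)) / 2 - 1) / ln 2"
  proof -
    have "measure_pmf.expectation P (\<lambda>x. (g x / 2 - 1) / ln 2) = (measure_pmf.expectation P g / 2 - 1) / ln 2"
      if "integrable (measure_pmf P) g" for g :: "('m rv \<Rightarrow> 'y val) \<Rightarrow> real"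
      using that by simp
    thus ?thesis using intr' by blast
  qed
  also have "measure_pmf.expectation P (\<lambda>x. ?r (sub {Sign, Out} x)) = measure_pmf.expectation ?Q ?r"
    by (simp add: marginal_def)
  also have "(\<dots> / 2 - 1) / ln 2 \<le> 0" using Er by (intro divide_nonpos_pos) auto
  finally show ?thesis by simp
qed

text \<open>Under a point mass each bit is constant, so every \<open>H(B\<^sub>j|Y)\<close>
  vanishes; what remains is \<open>H(S|Y)\<close> for a binary sign.\<close>

lemma match_entropy_return_pmf_le_1:
  fixes W :: "int \<Rightarrow> 'y pmf" and f :: "('m::finite \<Rightarrow> bool) \<Rightarrow> int" and b :: "'m \<Rightarrow> bool"
  assumes fin: "\<And>J. has_finite_entropy (joint_law W f (return_pmf b)) J"
  shows "match_entropy (joint_law W f (return_pmf b)) \<le> 1"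
proof -
  let ?P = "joint_law W f (return_pmf b)"
  have P: "\<exists>s\<in>signs. \<exists>y. x = letter b s y" if "x \<in> set_pmf ?P" for x
    using set_letter_lawD[of x W f b] that by (simp add: joint_law_eq bind_return_pmf)
  have "ent ?P {Bit j, Out} = ent ?P {Out}" for j
  proof -
    have "pmf (marginal ?P {Bit j, Out}) (sub {Bit j, Out} x) = pmf (marginal ?P {Out}) (sub {Out} x)"
      if x: "x \<in> set_pmf ?P" for x
      unfolding marginal_def pmf_map
    proof (rule measure_pmf.finite_measure_eq_AE)
      show "AE x' in measure_pmf ?P. x' \<in> sub {Bit j, Out} -` {sub {Bit j, Out} x} \<longleftrightarrow> x' \<in> sub {Out} -` {sub {Out} x}"
        unfolding AE_measure_pmf_iff
      proof
        fix x' assume "x' \<in> set_pmf ?P"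
        hence "x' (Bit j) = x (Bit j)" using P[OF x] P[of x'] by auto
        thus "x' \<in> sub {Bit j, Out} -` {sub {Bit j, Out} x} \<longleftrightarrow> x' \<in> sub {Out} -` {sub {Out} x}"
          by (auto simp: restrict_def fun_eq_iff)
      qed
    qed auto
    thus ?thesis
      unfolding ent_eq_expectation[OF fin] by (intro arg_cong[of _ _ uminus] integral_cong_AE) (auto simp: AE_measure_pmf_iff)
  qed
  moreover have "ent ?P {Sign, Out} - ent ?P {Out} \<le> 1"
    by (rule ent_Sign_given_Out_le_1[OF fin]) (use P in fastforce)
  ultimately show ?thesis by (simp add: match_entropy_def)
qed

theorem theorem3:
  fixes W :: "int \<Rightarrow> 'y::countable pmf"
    and f :: "('m::finite \<Rightarrow> bool) \<Rightarrow> int"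
    and M :: nat
  assumes M: "M = 2 ^ (CARD('m) + 1)"
    and labeling: "bij_betw f UNIV (amplitudes M)"
    and finite_entropies: "\<And>p J. has_finite_entropy (joint_law W f p) J"
  shows "\<exists>p. is_arg_max (\<lambda>q. ent (joint_law W f q) Bits)
               (\<lambda>q. ent (joint_law W f q) Bits \<le> R_BMD W f q) p \<and>
             achievable W f (ent (joint_law W f p) Bits)"
proof -
  note fin = finite_entropies
  have feasible: "ent (joint_law W f q) Bits \<le> R_BMD W f q \<longleftrightarrow> match_entropy (joint_law W f q) \<le> 1" for q
    unfolding R_BMD_eq[OF fin] by auto
  define C where "C = {v \<in> prob_simplex. match_entropy (joint_law W f (pmf_of_vec v)) \<le> 1}"
  have "closed C" unfolding C_def by (rule closed_match_entropy_le[OF fin])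
  with compact_prob_simplex have "compact (prob_simplex \<inter> C)" by (rule compact_Int_closed)
  also have "prob_simplex \<inter> C = C" unfolding C_def by blast
  finally have "compact C" .
  \<comment> \<open>Any bit pattern would do here; \<open>undefined\<close> serves as an arbitrary
    one.\<close>
  moreover have "(\<chi> b. pmf (return_pmf undefined) b) \<in> C"
    by (simp only: C_def mem_Collect_eq vec_of_pmf match_entropy_return_pmf_le_1[OF fin] simp_thms)
  hence "C \<noteq> {}" by blast
  moreover have "continuous_on C (\<lambda>v. ent (joint_law W f (pmf_of_vec v)) Bits)"
  proof (rule continuous_on_eq)
    show "continuous_on C (\<lambda>v. - (\<Sum>b\<in>UNIV. v $ b * log 2 (v $ b)))"
      by (intro continuous_intros continuous_on_compose2[OF continuous_on_mult_log])
         (auto simp: C_def prob_simplex_def)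
    show "- (\<Sum>b\<in>UNIV. v $ b * log 2 (v $ b)) = ent (joint_law W f (pmf_of_vec v)) Bits" if "v \<in> C" for v
      using that by (simp add: ent_Bits[OF fin] pmf_pmf_of_vec C_def)
  qed
  ultimately obtain v where v: "v \<in> C"
    and max: "\<And>w. w \<in> C \<Longrightarrow> ent (joint_law W f (pmf_of_vec w)) Bits \<le> ent (joint_law W f (pmf_of_vec v)) Bits"
    using continuous_attains_sup[of C] by blast
  define p where "p = pmf_of_vec v"
  have mp: "match_entropy (joint_law W f p) \<le> 1" using v by (simp add: C_def p_def)
  \<comment> \<open>Every distribution is represented by the vector of its probabilities, so the
    maximum over vectors covers all feasible distributions.\<close>
  have "ent (joint_law W f q) Bits \<le> ent (joint_law W f p) Bits" if "match_entropy (joint_law W f q) \<le> 1" for q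
    using max[of "\<chi> b. pmf q b"] that by (simp add: C_def vec_of_pmf p_def)
  hence "is_arg_max (\<lambda>q. ent (joint_law W f q) Bits) (\<lambda>q. ent (joint_law W f q) Bits \<le> R_BMD W f q) p"
    using mp by (auto simp: is_arg_max_linorder feasible)
  moreover have "achievable W f (ent (joint_law W f p) Bits)"
    by (rule achievable_entropy[OF fin mp])
  ultimately show ?thesis by blast
qed


end
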